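(* Let $\mathcal C$ be a modular connected system and let $L$ be its sum. Then the dissection of $L$ is isomorphic (as a modular connected system) to $\mathcal C$.
   Context: A lattice is locally finite if every closed interval is finite; it has finite covers if every element has finitely many upper and lower covers; it is l.f.f.c. if both hold. $x\lessdot y$ means $y$ covers $x$. A tolerance on a lattice $S$ is a reflexive, symmetric relation $\gamma$ such that $a\,\gamma\,b$ and $c\,\gamma\,d$ imply $(a\vee c)\,\gamma\,(b\vee d)$ and $(a\wedge c)\,\gamma\,(b\wedge d)$; write $x\le_\gamma y$ for ($x\le y$ and $x\,\gamma\,y$). A modular connected system (m.c. system) $\mathcal C=(S,\gamma,(L_x)_{x\in S},(\varphi_x^y)_{x\le_\gamma y})$ consists of a lattice $S$, a tolerance $\gamma$ on $S$, lattices $L_x$ and maps $\varphi_x^y$ such that: (MC1) $S$ is l.f.f.c.; (MC2) each $L_x$ is finite, modular, complemented; (MC3) each $\varphi_x^y$ is a lattice isomorphism from a nonempty lattice filter $F_x^y$ of $L_x$ onto a lattice ideal $I_x^y$ of $L_y$; (MC4) $F_x^x=I_x^x=L_x$, $\varphi_x^x=\mathrm{id}$; (MC5) if $x\le_\gamma y\le_\gamma z$ and $I_x^y\cap F_y^z\ne\emptyset$ then $x\,\gamma\,z$; (MC6) if $x\le z\le y$ and $x\,\gamma\,y$ then $F_x^y=(\varphi_x^z)^{-1}(I_x^z\cap F_z^y)$, $I_x^y=\varphi_z^y(I_x^z\cap F_z^y)$, $\varphi_x^y=\varphi_z^y\circ\varphi_x^z|_{F_x^y}$; (MC7) if $x\,\gamma\,y$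 then $I_x^{x\vee y}\cap I_y^{x\vee y}\subseteq I_{x\wedge y}^{x\vee y}$ and $F_{x\wedge y}^x\cap F_{x\wedge y}^y\subseteq F_{x\wedge y}^{x\vee y}$; (MC8.1) $x\lessdot y$ implies $x\,\gamma\,y$; (MC8.2) $x\lessdot y$ implies $F_x^y\ne L_x$ and $I_x^y\ne L_y$. An isomorphism from $\mathcal C$ to $\mathcal C'=(S',\gamma',(L'_x),(\varphi'^y_x))$ is a lattice isomorphism $\chi_S:S\to S'$ with lattice isomorphisms $\chi_x:L_x\to L'_{\chi_S(x)}$ such that $x\,\gamma\,y\iff\chi_S(x)\,\gamma'\,\chi_S(y)$ and, for $x\le_\gamma y$, $F'^{\chi_S(y)}_{\chi_S(x)}=\chi_x(F_x^y)$, $I'^{\chi_S(y)}_{\chi_S(x)}=\chi_y(I_x^y)$, $\chi_y\circ\varphi_x^y=\varphi'^{\chi_S(y)}_{\chi_S(x)}\circ\chi_x$ on $F_x^y$. Sum: $M=\{(x,a):x\in S,a\in L_x\}$, $(x,a)\sim(y,b)$ iff $x\,\gamma\,y$, $a\in F_x^{x\vee y}$, $b\in F_y^{x\vee y}$, $\varphi_x^{x\vee y}(a)=\varphi_y^{x\vee y}(b)$ (an equivalence relation); $L=M/{\sim}$, $\pi_x(a)$ the class of $(x,a)$, $\Lambda_x=\pi_x(L_x)$. For $v\in S$, $a\le_v b$ iff $a,b\in\Lambda_v$ and $\pi_v^{-1}a\le\pi_v^{-1}b$ in $L_v$; $a\le b$ in $L$ iff there are $n\ge0$, $x_1\le\dots\le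 x_n$ in $S$ and $a=a_0\le_{x_1}a_1\le_{x_2}\cdots\le_{x_n}a_n=b$. With this order $L$ is a modular l.f.f.c. lattice. Dissection of a modular l.f.f.c. lattice $L$: for $x\in L$, $x^*=x$ if $x$ is the top of $L$, else the join of the upper covers of $x$; dually $x_*$. A block is a maximal complemented interval $B=[0_B,1_B]$ of $L$. The set $S$ of blocks, ordered by $B\le C$ iff $0_B\le0_C$, is a lattice. The dissection is the m.c. system with skeleton $S$, tolerance $B\,\gamma\,C$ iff $B\cap C\ne\emptyset$, blocks $L_B=B$ (order from $L$), and for $B\le C$, $B\cap C\ne\emptyset$: $F_B^C=I_B^C=B\cap C$, $\varphi_B^C$ the identity. *)

theory Defs
  imports "HOL-Algebra.Lattice"
begin

section \<open>Lattice-theoretic notions\<close>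

definition covers :: "('a, 'm) gorder_scheme \<Rightarrow> 'a \<Rightarrow> 'a \<Rightarrow> bool" where
  "covers L x y \<longleftrightarrow> x \<in> carrier L \<and> y \<in> carrier L \<and> x \<sqsubset>\<^bsub>L\<^esub> y
     \<and> \<not> (\<exists>z \<in> carrier L. x \<sqsubset>\<^bsub>L\<^esub> z \<and> z \<sqsubset>\<^bsub>L\<^esub> y)"

definition locally_finite :: "('a, 'm) gorder_scheme \<Rightarrow> bool" where
  "locally_finite L \<longleftrightarrow> (\<forall>x \<in> carrier L. \<forall>y \<in> carrier L. finite \<lbrace>x..y\<rbrace>\<^bsub>L\<^esub>)"

definition finite_covers :: "('a, 'm) gorder_scheme \<Rightarrow> bool" where
  "finite_covers L \<longleftrightarrow> (\<forall>x \<in> carrier L. finite {y. covers L x y} \<and> finite {y. covers L y x})"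

definition lffc :: "('a, 'm) gorder_scheme \<Rightarrow> bool" where
  "lffc L \<longleftrightarrow> locally_finite L \<and> finite_covers L"

definition modular_lattice :: "('a, 'm) gorder_scheme \<Rightarrow> bool" where
  "modular_lattice L \<longleftrightarrow> lattice L
     \<and> (\<forall>x \<in> carrier L. \<forall>y \<in> carrier L. \<forall>z \<in> carrier L.
          x \<sqsubseteq>\<^bsub>L\<^esub> z \<longrightarrow> x \<squnion>\<^bsub>L\<^esub> (y \<sqinter>\<^bsub>L\<^esub> z) = (x \<squnion>\<^bsub>L\<^esub> y) \<sqinter>\<^bsub>L\<^esub> z)"

definition complemented_lattice :: "('a, 'm) gorder_scheme \<Rightarrow> bool" where
  "complemented_lattice L \<longleftrightarrow> bounded_lattice L
     \<and> (\<forall>x \<in> carrier L. \<exists>y \<in> carrier L. x \<sqinter>\<^bsub>L\<^esub> y = \<bottom>\<^bsub>L\<^esub> \<and> x \<squnion>\<^bsub>L\<^esub> y = \<top>\<^bsub>L\<^esub>)"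

definition lattice_filter :: "('a, 'm) gorder_scheme \<Rightarrow> 'a set \<Rightarrow> bool" where
  "lattice_filter L F \<longleftrightarrow> F \<subseteq> carrier L
     \<and> (\<forall>x \<in> F. \<forall>y \<in> F. x \<sqinter>\<^bsub>L\<^esub> y \<in> F)
     \<and> (\<forall>x \<in> F. \<forall>y \<in> carrier L. x \<sqsubseteq>\<^bsub>L\<^esub> y \<longrightarrow> y \<in> F)"

definition lattice_ideal :: "('a, 'm) gorder_scheme \<Rightarrow> 'a set \<Rightarrow> bool" where
  "lattice_ideal L I \<longleftrightarrow> I \<subseteq> carrier L
     \<and> (\<forall>x \<in> I. \<forall>y \<in> I. x \<squnion>\<^bsub>L\<^esub> y \<in> I)
     \<and> (\<forall>x \<in> I. \<forall>y \<in> carrier L. y \<sqsubseteq>\<^bsub>L\<^esub> x \<longrightarrow> y \<in> I)"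

definition lattice_iso :: "('a, 'm) gorder_scheme \<Rightarrow> ('b, 'n) gorder_scheme \<Rightarrow> ('a \<Rightarrow> 'b) \<Rightarrow> bool" where
  "lattice_iso L M f \<longleftrightarrow> bij_betw f (carrier L) (carrier M) \<and> join_pres L M f \<and> meet_pres L M f"

definition tolerance :: "('a, 'm) gorder_scheme \<Rightarrow> ('a \<times> 'a) set \<Rightarrow> bool" where
  "tolerance L \<gamma> \<longleftrightarrow> \<gamma> \<subseteq> carrier L \<times> carrier L \<and> refl_on (carrier L) \<gamma> \<and> sym \<gamma>
     \<and> (\<forall>a b c d. (a, b) \<in> \<gamma> \<longrightarrow> (c, d) \<in> \<gamma> \<longrightarrow>
          (a \<squnion>\<^bsub>L\<^esub> c, b \<squnion>\<^bsub>L\<^esub> d) \<in> \<gamma> \<and> (a \<sqinter>\<^bsub>L\<^esub> c, b \<sqinter>\<^bsub>L\<^esub> d) \<in> \<gamma>)"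


section \<open>Modular connected systems\<close>

text \<open>
  HOL functions are total, so the domain of the partial map \<open>\<phi>\<^sub>x\<^sup>y\<close> is a component
  \<open>Fil C x y\<close> of its own; its image is the derived \<open>Idl C x y\<close>. The values of \<open>Blk\<close>, \<open>Fil\<close>
  and \<open>Phi\<close> at indices not satisfying \<open>x \<le>\<^sub>\<gamma> y\<close>, and of \<open>Phi C x y\<close> outside \<open>Fil C x y\<close>,
  carry no meaning.
\<close>

record ('s, 'a) mc_data =
  Skel :: "'s gorder"
  Tol :: "('s \<times> 's) set"
  Blk :: "'s \<Rightarrow> 'a gorder"
  Fil :: "'s \<Rightarrow> 's \<Rightarrow> 'a set"
  Phi :: "'s \<Rightarrow> 's \<Rightarrow> 'a \<Rightarrow> 'a"

definition Idl :: "('s, 'a) mc_data \<Rightarrow> 's \<Rightarrow> 's \<Rightarrow> 'a set" where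
  "Idl C x y = Phi C x y ` Fil C x y"

definition tol_le :: "('s, 'a) mc_data \<Rightarrow> 's \<Rightarrow> 's \<Rightarrow> bool" where
  "tol_le C x y \<longleftrightarrow> x \<sqsubseteq>\<^bsub>Skel C\<^esub> y \<and> (x, y) \<in> Tol C"

locale mc_system =
  fixes C :: "('s, 'a) mc_data"
  assumes skeleton_lattice: "lattice (Skel C)"
    and tolerance: "tolerance (Skel C) (Tol C)"
    and MC1: "lffc (Skel C)"
    and MC2: "x \<in> carrier (Skel C) \<Longrightarrow>
          finite (carrier (Blk C x)) \<and> modular_lattice (Blk C x) \<and> complemented_lattice (Blk C x)"
    and MC3: "tol_le C x y \<Longrightarrow>
          Fil C x y \<noteq> {} \<and> lattice_filter (Blk C x) (Fil C x y) \<and> lattice_ideal (Blk C y) (Idl C x y)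
          \<and> lattice_iso ((Blk C x)\<lparr>carrier := Fil C x y\<rparr>) ((Blk C y)\<lparr>carrier := Idl C x y\<rparr>) (Phi C x y)"
    and MC4: "x \<in> carrier (Skel C) \<Longrightarrow>
          Fil C x x = carrier (Blk C x) \<and> Idl C x x = carrier (Blk C x)
          \<and> (\<forall>a \<in> carrier (Blk C x). Phi C x x a = a)"
    and MC5: "tol_le C x y \<Longrightarrow> tol_le C y z \<Longrightarrow> Idl C x y \<inter> Fil C y z \<noteq> {} \<Longrightarrow> (x, z) \<in> Tol C"
    and MC6: "x \<in> carrier (Skel C) \<Longrightarrow> z \<in> carrier (Skel C) \<Longrightarrow> y \<in> carrier (Skel C) \<Longrightarrow>
          x \<sqsubseteq>\<^bsub>Skel C\<^esub> z \<Longrightarrow> z \<sqsubseteq>\<^bsub>Skel C\<^esub> y \<Longrightarrow> (x, y) \<in> Tol C \<Longrightarrow>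
          Fil C x y = {a \<in> Fil C x z. Phi C x z a \<in> Idl C x z \<inter> Fil C z y}
          \<and> Idl C x y = Phi C z y ` (Idl C x z \<inter> Fil C z y)
          \<and> (\<forall>a \<in> Fil C x y. Phi C x y a = Phi C z y (Phi C x z a))"
    and MC7: "(x, y) \<in> Tol C \<Longrightarrow>
          Idl C x (x \<squnion>\<^bsub>Skel C\<^esub> y) \<inter> Idl C y (x \<squnion>\<^bsub>Skel C\<^esub> y)
            \<subseteq> Idl C (x \<sqinter>\<^bsub>Skel C\<^esub> y) (x \<squnion>\<^bsub>Skel C\<^esub> y)
          \<and> Fil C (x \<sqinter>\<^bsub>Skel C\<^esub> y) x \<inter> Fil C (x \<sqinter>\<^bsub>Skel C\<^esub> y) y
            \<subseteq> Fil C (x \<sqinter>\<^bsub>Skel C\<^esub> y) (x \<squnion>\<^bsub>Skel C\<^esub> y)"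
    and MC8_1: "covers (Skel C) x y \<Longrightarrow> (x, y) \<in> Tol C"
    and MC8_2: "covers (Skel C) x y \<Longrightarrow>
          Fil C x y \<noteq> carrier (Blk C x) \<and> Idl C x y \<noteq> carrier (Blk C y)"

definition mc_isomorphism ::
  "('s, 'a) mc_data \<Rightarrow> ('t, 'b) mc_data \<Rightarrow> ('s \<Rightarrow> 't) \<Rightarrow> ('s \<Rightarrow> 'a \<Rightarrow> 'b) \<Rightarrow> bool" where
  "mc_isomorphism C C' \<chi>S \<chi> \<longleftrightarrow> mc_system C \<and> mc_system C'
     \<and> lattice_iso (Skel C) (Skel C') \<chi>S
     \<and> (\<forall>x \<in> carrier (Skel C). lattice_iso (Blk C x) (Blk C' (\<chi>S x)) (\<chi> x))
     \<and> (\<forall>x \<in> carrier (Skel C). \<forall>y \<in> carrier (Skel C).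
          (x, y) \<in> Tol C \<longleftrightarrow> (\<chi>S x, \<chi>S y) \<in> Tol C')
     \<and> (\<forall>x y. tol_le C x y \<longrightarrow>
          Fil C' (\<chi>S x) (\<chi>S y) = \<chi> x ` Fil C x y
          \<and> Idl C' (\<chi>S x) (\<chi>S y) = \<chi> y ` Idl C x y
          \<and> (\<forall>a \<in> Fil C x y. \<chi> y (Phi C x y a) = Phi C' (\<chi>S x) (\<chi>S y) (\<chi> x a)))"

definition mc_isomorphic :: "('s, 'a) mc_data \<Rightarrow> ('t, 'b) mc_data \<Rightarrow> bool" where
  "mc_isomorphic C C' \<longleftrightarrow> (\<exists>\<chi>S \<chi>. mc_isomorphism C C' \<chi>S \<chi>)"


section \<open>The sum of an m.c. system\<close>

definition sum_points :: "('s, 'a) mc_data \<Rightarrow> ('s \<times> 'a) set" where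
  "sum_points C = (SIGMA x : carrier (Skel C). carrier (Blk C x))"

definition sum_rel :: "('s, 'a) mc_data \<Rightarrow> (('s \<times> 'a) \<times> ('s \<times> 'a)) set" where
  "sum_rel C = {((x, a), (y, b)) | x a y b.
     (x, a) \<in> sum_points C \<and> (y, b) \<in> sum_points C \<and> (x, y) \<in> Tol C
     \<and> a \<in> Fil C x (x \<squnion>\<^bsub>Skel C\<^esub> y) \<and> b \<in> Fil C y (x \<squnion>\<^bsub>Skel C\<^esub> y)
     \<and> Phi C x (x \<squnion>\<^bsub>Skel C\<^esub> y) a = Phi C y (x \<squnion>\<^bsub>Skel C\<^esub> y) b}"

definition sum_proj :: "('s, 'a) mc_data \<Rightarrow> 's \<Rightarrow> 'a \<Rightarrow> ('s \<times> 'a) set" where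
  "sum_proj C x a = sum_rel C `` {(x, a)}"

definition sum_block :: "('s, 'a) mc_data \<Rightarrow> 's \<Rightarrow> ('s \<times> 'a) set set" where
  "sum_block C x = sum_proj C x ` carrier (Blk C x)"

text \<open>
  By MC4, \<open>(v, a) \<sim> (v, b)\<close> only if \<open>a = b\<close>, so \<open>sum_proj C v\<close> is injective on the carrier of
  \<open>Blk C v\<close> and the inverse below is genuine.
\<close>

definition sum_le_at :: "('s, 'a) mc_data \<Rightarrow> 's \<Rightarrow> ('s \<times> 'a) set \<Rightarrow> ('s \<times> 'a) set \<Rightarrow> bool" where
  "sum_le_at C v a b \<longleftrightarrow> a \<in> sum_block C v \<and> b \<in> sum_block C v
     \<and> the_inv_into (carrier (Blk C v)) (sum_proj C v) a
         \<sqsubseteq>\<^bsub>Blk C v\<^esub> the_inv_into (carrier (Blk C v)) (sum_proj C v) b"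

definition sum_le :: "('s, 'a) mc_data \<Rightarrow> ('s \<times> 'a) set \<Rightarrow> ('s \<times> 'a) set \<Rightarrow> bool" where
  "sum_le C a b \<longleftrightarrow> a \<in> sum_points C // sum_rel C \<and> b \<in> sum_points C // sum_rel C
     \<and> (\<exists>(n::nat) x c. c 0 = a \<and> c n = b
          \<and> (\<forall>i \<in> {1..n}. x i \<in> carrier (Skel C) \<and> sum_le_at C (x i) (c (i - 1)) (c i))
          \<and> (\<forall>i \<in> {1..<n}. x i \<sqsubseteq>\<^bsub>Skel C\<^esub> x (i + 1)))"

definition mc_sum :: "('s, 'a) mc_data \<Rightarrow> ('s \<times> 'a) set gorder" where
  "mc_sum C = \<lparr>carrier = sum_points C // sum_rel C, eq = (=), le = sum_le C\<rparr>"


section \<open>The dissection of a modular l.f.f.c. lattice\<close>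

definition complemented_interval :: "'a gorder \<Rightarrow> 'a set \<Rightarrow> bool" where
  "complemented_interval L B \<longleftrightarrow>
     (\<exists>a \<in> carrier L. \<exists>b \<in> carrier L. a \<sqsubseteq>\<^bsub>L\<^esub> b \<and> B = \<lbrace>a..b\<rbrace>\<^bsub>L\<^esub>)
     \<and> complemented_lattice (L\<lparr>carrier := B\<rparr>)"

definition is_block :: "'a gorder \<Rightarrow> 'a set \<Rightarrow> bool" where
  "is_block L B \<longleftrightarrow> complemented_interval L B
     \<and> (\<forall>B'. complemented_interval L B' \<longrightarrow> B \<subseteq> B' \<longrightarrow> B' = B)"

text \<open>For a block \<open>B = [0\<^sub>B, 1\<^sub>B]\<close>, the element \<open>0\<^sub>B\<close> is the bottom of \<open>L\<close> restricted to \<open>B\<close>.\<close>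

definition block_skeleton :: "'a gorder \<Rightarrow> 'a set gorder" where
  "block_skeleton L = \<lparr>carrier = {B. is_block L B}, eq = (=),
     le = (\<lambda>B B'. \<bottom>\<^bsub>L\<lparr>carrier := B\<rparr>\<^esub> \<sqsubseteq>\<^bsub>L\<^esub> \<bottom>\<^bsub>L\<lparr>carrier := B'\<rparr>\<^esub>)\<rparr>"

definition dissection :: "'a gorder \<Rightarrow> ('a set, 'a) mc_data" where
  "dissection L = \<lparr>Skel = block_skeleton L,
     Tol = {(B, B'). is_block L B \<and> is_block L B' \<and> B \<inter> B' \<noteq> {}},
     Blk = (\<lambda>B. L\<lparr>carrier := B\<rparr>),
     Fil = (\<lambda>B B'. B \<inter> B'),
     Phi = (\<lambda>B B' a. a)\<rparr>"

end

theory Submission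
  imports Defs
begin

text \<open>
  Write \<open>\<Lambda>\<^sub>x\<close> for the image of \<open>L\<^sub>x\<close> in the sum. The indices of the blocks through a given element form a
  convex sublattice of the skeleton, and a step \<open>a \<le>\<^sub>x b\<close> may be replaced by a step in \<open>\<Lambda>\<^sub>y\<close> with \<open>y \<ge> x\<close> if
  \<open>a \<in> \<Lambda>\<^sub>y\<close>, and with \<open>y \<le> x\<close> if \<open>b \<in> \<Lambda>\<^sub>y\<close>. Shifting chains accordingly shows that the order of the sum is
  transitive and antisymmetric, that it restricts to the order of \<open>L\<^sub>x\<close> on \<open>\<Lambda>\<^sub>x\<close>, and that \<open>\<Lambda>\<^sub>x\<close> is an
  interval. By (MC8.2) the least element of \<open>\<Lambda>\<^sub>y\<close> lies in \<open>\<Lambda>\<^sub>x\<close> only if \<open>x \<le> y\<close>, hence \<open>x \<le> y\<close> iff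
  \<open>0\<^sub>x \<le> 0\<^sub>y\<close>, and no \<open>\<Lambda>\<^sub>x\<close> contains another one. An induction on intervals of the skeleton shows that
  joins in \<open>\<Lambda>\<^sub>x\<close> are joins in the sum; with it every complemented interval is seen to lie in some \<open>\<Lambda>\<^sub>x\<close>,
  so the \<open>\<Lambda>\<^sub>x\<close> are exactly the blocks of the sum.
\<close>

section \<open>Order isomorphisms\<close>

text \<open>The blocks of a system are unrelated lattices joined by partial maps, whereas the blocks
  of a dissection are overlapping subsets of one order joined by identities. The locale
  \<open>gluing\<close> mediates: its blocks already overlap inside one type, so that filters and
  ideals are intersections and the connecting maps disappear. The conditions on a system split
  accordingly. MC5, MC6 and the filter half of MC7 make the gluing relation transitive. The shape of
  that relation, the ideal half of MC7 and MC6 give closure of the indices through a point under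
  joins, meets and betweenness. MC3 makes the local orders agree on overlaps, and MC8.2 makes
  neighbouring blocks incomparable. The main obstacle lies in the order of the sum: its chains have
  rising indices, so two of them cannot simply be concatenated when the second begins at an index
  not above the last index of the first. Moving a chain to other indices without changing its
  elements removes this obstacle. That the dissection is a modular connected system is read off from
  the same family of blocks, by transport along the bijection from indices to blocks.\<close>

locale order_isomorphism = L: partial_order L for L :: "('a, 'm) gorder_scheme" +
  fixes M :: "('b, 'n) gorder_scheme" and f :: "'a \<Rightarrow> 'b"
  assumes eq_target: "eq M = (=)"
    and bij: "bij_betw f (carrier L) (carrier M)"
    and le_iff: "x \<in> carrier L \<Longrightarrow> y \<in> carrier L \<Longrightarrow> f x \<sqsubseteq>\<^bsub>M\<^esub> f y \<longleftrightarrow> x \<sqsubseteq>\<^bsub>L\<^esub> y"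
begin

lemma image_carrier: "f ` carrier L = carrier M"
  using bij by (rule bij_betw_imp_surj_on)

lemma closed: "x \<in> carrier L \<Longrightarrow> f x \<in> carrier M"
  using image_carrier by blast

lemma inj: "x \<in> carrier L \<Longrightarrow> y \<in> carrier L \<Longrightarrow> f x = f y \<longleftrightarrow> x = y"
  using bij by (meson bij_betw_def inj_on_eq_iff)

lemma obtain_preimage:
  assumes "u \<in> carrier M" obtains x where "x \<in> carrier L" "u = f x"
  using assms image_carrier by blast

lemma partial_order_target: "partial_order M"
proof -
  have refl: "u \<sqsubseteq>\<^bsub>M\<^esub> u" if "u \<in> carrier M" for u
    using that unfolding image_carrier[symmetric] by (auto simp: le_iff)
  have antisym: "u = v" if "u \<sqsubseteq>\<^bsub>M\<^esub> v" "v \<sqsubseteq>\<^bsub>M\<^esub> u" "u \<in> carrier M" "v \<in> carrier M" for u v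
    using that unfolding image_carrier[symmetric] by (auto simp: le_iff dest: L.le_antisym)
  have trans: "u \<sqsubseteq>\<^bsub>M\<^esub> w"
    if "u \<sqsubseteq>\<^bsub>M\<^esub> v" "v \<sqsubseteq>\<^bsub>M\<^esub> w" "u \<in> carrier M" "v \<in> carrier M" "w \<in> carrier M" for u v w
    using that unfolding image_carrier[symmetric] by (auto simp: le_iff intro: L.le_trans)
  show ?thesis
    by unfold_locales (simp_all add: eq_target refl antisym, metis trans)
qed

lemma least_image:
  assumes "A \<subseteq> carrier L" "x \<in> carrier L" shows "least M (f x) (f ` A) \<longleftrightarrow> least L x A"
proof -
  have "f x \<in> f ` A \<longleftrightarrow> x \<in> A" using assms inj by blast
  moreover have "(\<forall>y \<in> A. f x \<sqsubseteq>\<^bsub>M\<^esub> f y) \<longleftrightarrow> (\<forall>y \<in> A. x \<sqsubseteq>\<^bsub>L\<^esub> y)" using assms le_iff by blast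
  moreover have "f ` A \<subseteq> carrier M" using assms closed by blast
  ultimately show ?thesis using assms by (simp add: least_def)
qed

lemma greatest_image:
  assumes "A \<subseteq> carrier L" "x \<in> carrier L" shows "greatest M (f x) (f ` A) \<longleftrightarrow> greatest L x A"
proof -
  have "f x \<in> f ` A \<longleftrightarrow> x \<in> A" using assms inj by blast
  moreover have "(\<forall>y \<in> A. f y \<sqsubseteq>\<^bsub>M\<^esub> f x) \<longleftrightarrow> (\<forall>y \<in> A. y \<sqsubseteq>\<^bsub>L\<^esub> x)" using assms le_iff by blast
  moreover have "f ` A \<subseteq> carrier M" using assms closed by blast
  ultimately show ?thesis using assms by (simp add: greatest_def)
qed

lemma Upper_image: "A \<subseteq> carrier L \<Longrightarrow> Upper M (f ` A) = f ` Upper L A"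
proof -
  assume A: "A \<subseteq> carrier L"
  then have "Upper M (f ` A) = {u \<in> f ` carrier L. \<forall>y \<in> A. f y \<sqsubseteq>\<^bsub>M\<^esub> u}"
    using closed by (auto simp: Upper_def image_carrier)
  also have "\<dots> = f ` Upper L A" using A by (auto simp: Upper_def le_iff subset_iff)
  finally show ?thesis .
qed

lemma Lower_image: "A \<subseteq> carrier L \<Longrightarrow> Lower M (f ` A) = f ` Lower L A"
proof -
  assume A: "A \<subseteq> carrier L"
  then have "Lower M (f ` A) = {u \<in> f ` carrier L. \<forall>y \<in> A. u \<sqsubseteq>\<^bsub>M\<^esub> f y}"
    using closed by (auto simp: Lower_def image_carrier)
  also have "\<dots> = f ` Lower L A" using A by (auto simp: Lower_def le_iff subset_iff)
  finally show ?thesis .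
qed

lemma lub_image: "A \<subseteq> carrier L \<Longrightarrow> x \<in> carrier L \<Longrightarrow> is_lub M (f x) (f ` A) \<longleftrightarrow> is_lub L x A"
  by (simp add: Upper_image least_image)

lemma glb_image: "A \<subseteq> carrier L \<Longrightarrow> x \<in> carrier L \<Longrightarrow> is_glb M (f x) (f ` A) \<longleftrightarrow> is_glb L x A"
  by (simp add: Lower_image greatest_image)

lemma lattice_target:
  assumes "lattice L" shows "lattice M"
proof -
  interpret L': lattice L by fact
  interpret M: partial_order M by (rule partial_order_target)
  show ?thesis
  proof
    fix u v assume "u \<in> carrier M" "v \<in> carrier M"
    then obtain x y where xy: "x \<in> carrier L" "y \<in> carrier L" "u = f x" "v = f y"
      by (meson obtain_preimage)
    obtain s where "is_lub L s {x, y}" using xy(1,2) L'.sup_of_two_exists by blast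
    then show "\<exists>s. is_lub M s {u, v}"
      using lub_image[of "{x, y}" s] xy by (auto dest: least_closed)
    obtain s where "is_glb L s {x, y}" using xy(1,2) L'.inf_of_two_exists by blast
    then show "\<exists>s. is_glb M s {u, v}"
      using glb_image[of "{x, y}" s] xy by (auto dest: greatest_closed)
  qed
qed

lemma join_image:
  assumes "lattice L" and xy: "x \<in> carrier L" "y \<in> carrier L"
  shows "f (x \<squnion>\<^bsub>L\<^esub> y) = f x \<squnion>\<^bsub>M\<^esub> f y"
proof -
  interpret L': lattice L by fact
  interpret M: lattice M using \<open>lattice L\<close> by (rule lattice_target)
  have "is_lub M (f (\<Squnion>\<^bsub>L\<^esub>{x, y})) {f x, f y}"
    using lub_image[of "{x, y}"] L'.sup_of_two_least[OF xy] xy by (metis empty_subsetI image_empty image_insert insert_subset least_closed)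
  moreover have "is_lub M (\<Squnion>\<^bsub>M\<^esub>{f x, f y}) {f x, f y}"
    by (rule M.sup_of_two_least[OF closed[OF xy(1)] closed[OF xy(2)]])
  ultimately show ?thesis unfolding join_def by (rule M.least_unique)
qed

lemma meet_image:
  assumes "lattice L" and xy: "x \<in> carrier L" "y \<in> carrier L"
  shows "f (x \<sqinter>\<^bsub>L\<^esub> y) = f x \<sqinter>\<^bsub>M\<^esub> f y"
proof -
  interpret L': lattice L by fact
  interpret M: lattice M using \<open>lattice L\<close> by (rule lattice_target)
  have "is_glb M (f (\<Sqinter>\<^bsub>L\<^esub>{x, y})) {f x, f y}"
    using glb_image[of "{x, y}"] L'.inf_of_two_greatest[OF xy] xy by (metis empty_subsetI image_empty image_insert insert_subset greatest_closed)
  moreover have "is_glb M (\<Sqinter>\<^bsub>M\<^esub>{f x, f y}) {f x, f y}"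
    by (rule M.inf_of_two_greatest[OF closed[OF xy(1)] closed[OF xy(2)]])
  ultimately show ?thesis unfolding meet_def by (rule M.greatest_unique)
qed

text \<open>\<open>lattice_iso\<close> speaks of joins and meets and presupposes lattices on both
  sides. This reduces it to a comparison of orders, since all lattice structure of the target is
  transported.\<close>

lemma lattice_iso:
  assumes "lattice L" shows "lattice_iso L M f"
  unfolding lattice_iso_def join_pres_def meet_pres_def
  using bij assms lattice_target[OF assms] join_image[OF assms] meet_image[OF assms] by simp

lemma bounded_lattice_target:
  assumes "bounded_lattice L" shows "bounded_lattice M"
proof -
  interpret L': bounded_lattice L by fact
  interpret M: lattice M using L'.lattice_axioms by (rule lattice_target)
  show ?thesis
  proof
    show "\<exists>x. least M x (carrier M)"
      using least_image[of "carrier L" "\<bottom>\<^bsub>L\<^esub>"] L'.bottom_least by (auto simp: image_carrier)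
    show "\<exists>x. greatest M x (carrier M)"
      using greatest_image[of "carrier L" "\<top>\<^bsub>L\<^esub>"] L'.top_greatest by (auto simp: image_carrier)
  qed
qed

lemma bottom_image:
  assumes "bounded_lattice L" shows "f \<bottom>\<^bsub>L\<^esub> = \<bottom>\<^bsub>M\<^esub>"
proof -
  interpret L': bounded_lattice L by fact
  interpret M: bounded_lattice M using assms by (rule bounded_lattice_target)
  show ?thesis
    using least_image[of "carrier L" "\<bottom>\<^bsub>L\<^esub>"] L'.bottom_least M.bottom_least M.least_unique
    by (auto simp: image_carrier)
qed

lemma top_image:
  assumes "bounded_lattice L" shows "f \<top>\<^bsub>L\<^esub> = \<top>\<^bsub>M\<^esub>"
proof -
  interpret L': bounded_lattice L by fact
  interpret M: bounded_lattice M using assms by (rule bounded_lattice_target)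
  show ?thesis
    using greatest_image[of "carrier L" "\<top>\<^bsub>L\<^esub>"] L'.top_greatest M.top_greatest M.greatest_unique
    by (auto simp: image_carrier)
qed

lemma modular_target:
  assumes "modular_lattice L" shows "modular_lattice M"
proof -
  interpret L': lattice L using assms by (simp add: modular_lattice_def)
  note hom = join_image[OF L'.lattice_axioms, symmetric] meet_image[OF L'.lattice_axioms, symmetric]
  have "u \<squnion>\<^bsub>M\<^esub> (v \<sqinter>\<^bsub>M\<^esub> w) = (u \<squnion>\<^bsub>M\<^esub> v) \<sqinter>\<^bsub>M\<^esub> w"
    if "u \<in> carrier M" "v \<in> carrier M" "w \<in> carrier M" "u \<sqsubseteq>\<^bsub>M\<^esub> w" for u v w
    using that assms by (auto elim!: obtain_preimage simp: hom le_iff modular_lattice_def)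
  then show ?thesis using lattice_target[OF L'.lattice_axioms] by (simp add: modular_lattice_def)
qed

lemma complemented_target:
  assumes "complemented_lattice L" shows "complemented_lattice M"
proof -
  interpret L': bounded_lattice L using assms by (simp add: complemented_lattice_def)
  note L = L'.lattice_axioms and bL = L'.bounded_lattice_axioms
  have "\<exists>v \<in> carrier M. u \<sqinter>\<^bsub>M\<^esub> v = \<bottom>\<^bsub>M\<^esub> \<and> u \<squnion>\<^bsub>M\<^esub> v = \<top>\<^bsub>M\<^esub>" if u: "u \<in> carrier M" for u
  proof -
    obtain x where x: "x \<in> carrier L" "u = f x" by (rule obtain_preimage[OF u])
    obtain y where y: "y \<in> carrier L" "x \<sqinter>\<^bsub>L\<^esub> y = \<bottom>\<^bsub>L\<^esub>" "x \<squnion>\<^bsub>L\<^esub> y = \<top>\<^bsub>L\<^esub>"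
      using assms x(1) unfolding complemented_lattice_def by blast
    have "u \<sqinter>\<^bsub>M\<^esub> f y = \<bottom>\<^bsub>M\<^esub>"
      unfolding x(2) meet_image[OF L x(1) y(1), symmetric] y(2) by (rule bottom_image[OF bL])
    moreover have "u \<squnion>\<^bsub>M\<^esub> f y = \<top>\<^bsub>M\<^esub>"
      unfolding x(2) join_image[OF L x(1) y(1), symmetric] y(3) by (rule top_image[OF bL])
    ultimately show ?thesis using closed[OF y(1)] by blast
  qed
  then show ?thesis using bounded_lattice_target[OF bL] unfolding complemented_lattice_def by blast
qed

lemma covers_image: "x \<in> carrier L \<Longrightarrow> y \<in> carrier L \<Longrightarrow> covers M (f x) (f y) \<longleftrightarrow> covers L x y"
  unfolding covers_def lless_def eq_target L.eq_is_equal image_carrier[symmetric]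
  by (auto simp: le_iff inj)

lemma inverse: "order_isomorphism M L (the_inv_into (carrier L) f)"
proof -
  interpret M: partial_order M by (rule partial_order_target)
  have g: "the_inv_into (carrier L) f (f x) = x" if "x \<in> carrier L" for x
    using bij that by (simp add: bij_betw_def the_inv_into_f_f)
  show ?thesis
  proof
    show "bij_betw (the_inv_into (carrier L) f) (carrier M) (carrier L)"
      using bij by (rule bij_betw_the_inv_into)
    show "the_inv_into (carrier L) f u \<sqsubseteq>\<^bsub>L\<^esub> the_inv_into (carrier L) f v \<longleftrightarrow> u \<sqsubseteq>\<^bsub>M\<^esub> v"
      if "u \<in> carrier M" "v \<in> carrier M" for u v
      using that g le_iff unfolding image_carrier[symmetric] by auto
  qed (rule L.eq_is_equal)
qed

text \<open>Intervals and sets of covers in the target are images of those in the source, so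
  finiteness carries over.\<close>

lemma lffc_target:
  assumes "lffc L" shows "lffc M"
proof -
  have "\<lbrace>f x..f y\<rbrace>\<^bsub>M\<^esub> = f ` \<lbrace>x..y\<rbrace>\<^bsub>L\<^esub>" if "x \<in> carrier L" "y \<in> carrier L" for x y
    using that unfolding at_least_at_most_def image_carrier[symmetric] by (auto simp: le_iff)
  then have "locally_finite M"
    using assms unfolding lffc_def locally_finite_def image_carrier[symmetric] by auto
  moreover have "{v. covers M (f x) v} = f ` {y. covers L x y}"
    "{v. covers M v (f x)} = f ` {y. covers L y x}" if "x \<in> carrier L" for x
  proof -
    have "covers M u v \<Longrightarrow> u \<in> f ` carrier L \<and> v \<in> f ` carrier L" for u v
      by (simp add: covers_def image_carrier)
    moreover have "covers L u v \<Longrightarrow> u \<in> carrier L \<and> v \<in> carrier L" for u v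
      by (simp add: covers_def)
    ultimately show "{v. covers M (f x) v} = f ` {y. covers L x y}"
      "{v. covers M v (f x)} = f ` {y. covers L y x}"
      using that covers_image by blast+
  qed
  then have "finite_covers M"
    using assms unfolding lffc_def finite_covers_def image_carrier[symmetric] by auto
  ultimately show ?thesis by (simp add: lffc_def)
qed

end

text \<open>The order is encoded in joins, \<open>x \<squnion> y = y\<close>, and an injective map
  preserving joins therefore reflects it. The fact \<open>le_iff_meet\<close> is this
  characterisation by joins, in spite of its name.\<close>

lemma lattice_iso_le_iff:
  assumes "lattice_iso L M f" and xy: "x \<in> carrier L" "y \<in> carrier L"
  shows "f x \<sqsubseteq>\<^bsub>M\<^esub> f y \<longleftrightarrow> x \<sqsubseteq>\<^bsub>L\<^esub> y"
proof -
  have L: "lattice L" and M: "lattice M" and bij: "bij_betw f (carrier L) (carrier M)"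
    and join: "f (x \<squnion>\<^bsub>L\<^esub> y) = f x \<squnion>\<^bsub>M\<^esub> f y"
    using assms by (auto simp: lattice_iso_def join_pres_def)
  interpret L: lattice L by (rule L)
  interpret M: lattice M by (rule M)
  have mem: "f x \<in> carrier M" "f y \<in> carrier M" using bij xy bij_betwE by metis+
  have "f x \<sqsubseteq>\<^bsub>M\<^esub> f y \<longleftrightarrow> f (x \<squnion>\<^bsub>L\<^esub> y) = f y"
    unfolding join by (rule M.le_iff_meet[OF mem])
  also have "\<dots> \<longleftrightarrow> x \<squnion>\<^bsub>L\<^esub> y = y"
    using bij_betw_imp_inj_on[OF bij] L.join_closed[OF xy] xy(2) by (rule inj_on_eq_iff)
  finally show ?thesis by (simp only: L.le_iff_meet[OF xy])
qed

section \<open>Gluing lattices along a skeleton\<close>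

lemma covers_upward:
  assumes "partial_order S" "locally_finite S"
    and xy: "x \<in> carrier S" "y \<in> carrier S" "x \<sqsubseteq>\<^bsub>S\<^esub> y" "x \<noteq> y"
  obtains z where "covers S x z" "z \<sqsubseteq>\<^bsub>S\<^esub> y"
proof -
  interpret S: partial_order S by fact
  let ?A = "{z \<in> carrier S. x \<sqsubseteq>\<^bsub>S\<^esub> z \<and> z \<sqsubseteq>\<^bsub>S\<^esub> y \<and> z \<noteq> x}"
  let ?D = "\<lambda>z. {t \<in> ?A. t \<sqsubseteq>\<^bsub>S\<^esub> z}"
  have "?A \<subseteq> \<lbrace>x..y\<rbrace>\<^bsub>S\<^esub>" by (auto simp: at_least_at_most_def)
  then have fin: "finite ?A"
    using assms finite_subset unfolding locally_finite_def by blast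
  have "y \<in> ?A" using xy by auto
  \<comment> \<open>A member of the finite set \<open>?A\<close> with the fewest members of
    \<open>?A\<close> below it is minimal there, and a minimal member covers
    \<open>x\<close>.\<close>
  then obtain z where z: "z \<in> ?A" "\<forall>u. u \<in> ?A \<longrightarrow> card (?D z) \<le> card (?D u)"
    using ex_has_least_nat[of "\<lambda>z. z \<in> ?A" y "\<lambda>z. card (?D z)"] by blast
  have "\<not> (x \<sqsubset>\<^bsub>S\<^esub> u \<and> u \<sqsubset>\<^bsub>S\<^esub> z)" if u: "u \<in> carrier S" for u
  proof
    assume "x \<sqsubset>\<^bsub>S\<^esub> u \<and> u \<sqsubset>\<^bsub>S\<^esub> z"
    then have u': "x \<sqsubseteq>\<^bsub>S\<^esub> u" "u \<noteq> x" "u \<sqsubseteq>\<^bsub>S\<^esub> z" "u \<noteq> z" by (auto simp: S.lless_eq)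
    have zc: "z \<in> carrier S" "z \<sqsubseteq>\<^bsub>S\<^esub> y" using z(1) by simp_all
    have "u \<sqsubseteq>\<^bsub>S\<^esub> y" by (rule S.le_trans[OF u'(3) zc(2) u zc(1) xy(2)])
    then have "u \<in> ?A" using u u' by simp
    moreover have "?D u \<subset> ?D z"
    proof
      show "?D u \<subseteq> ?D z" using S.le_trans[OF _ u'(3) _ u zc(1)] by auto
      have "z \<in> ?D z" using z(1) by simp
      moreover have "z \<notin> ?D u" using S.le_antisym[OF u'(3) _ u zc(1)] u'(4) by auto
      ultimately show "?D u \<noteq> ?D z" by metis
    qed
    moreover have "finite (?D z)" by (rule finite_subset[OF _ fin]) blast
    ultimately have "u \<in> ?A \<and> card (?D u) < card (?D z)" by (meson psubset_card_mono)
    then show False using z(2) leD by blast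
  qed
  then have "covers S x z" using z(1) xy(1) by (auto simp: covers_def S.lless_eq)
  then show ?thesis using that z(1) by simp
qed

lemma covers_downward:
  assumes "partial_order S" "locally_finite S"
    and xy: "x \<in> carrier S" "y \<in> carrier S" "x \<sqsubseteq>\<^bsub>S\<^esub> y" "x \<noteq> y"
  obtains z where "covers S z y" "x \<sqsubseteq>\<^bsub>S\<^esub> z"
proof -
  interpret S: partial_order S by fact
  have "\<lbrace>u..v\<rbrace>\<^bsub>inv_gorder S\<^esub> = \<lbrace>v..u\<rbrace>\<^bsub>S\<^esub>" for u v by (auto simp: at_least_at_most_def)
  then have "locally_finite (inv_gorder S)"
    using assms(2) by (simp add: locally_finite_def)
  then obtain z where "covers (inv_gorder S) y z" "x \<sqsubseteq>\<^bsub>S\<^esub> z"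
    using covers_upward[OF S.dual_order, of y x] xy by auto
  moreover from this have "covers S z y"
    by (auto simp: covers_def lless_def S.eq_is_equal)
  ultimately show ?thesis using that by blast
qed

text \<open>Stated for a bare relation because it serves two different orders: that of the skeleton,
  on the indices of blocks through a point, and the glued order, on part of a single block.\<close>

lemma finite_directed_has_greatest:
  assumes "finite T" "T \<noteq> {}" "\<And>u v. u \<in> T \<Longrightarrow> v \<in> T \<Longrightarrow> \<exists>w \<in> T. R u w \<and> R v w"
    and trans: "\<And>u v w. u \<in> T \<Longrightarrow> v \<in> T \<Longrightarrow> w \<in> T \<Longrightarrow> R u v \<Longrightarrow> R v w \<Longrightarrow> R u w"
  shows "\<exists>m \<in> T. \<forall>u \<in> T. R u m"
proof -
  have "F \<subseteq> T \<Longrightarrow> \<exists>m \<in> T. \<forall>u \<in> F. R u m" if "finite F" "F \<noteq> {}" for F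
    using that
  proof (induction rule: finite_ne_induct)
    case (singleton u)
    then show ?case using assms(3) by blast
  next
    case (insert u F)
    then obtain m where m: "m \<in> T" "\<forall>v \<in> F. R v m" by blast
    obtain w where w: "w \<in> T" "R u w" "R m w" using assms(3) m(1) insert.prems by blast
    have "R v w" if "v \<in> F" for v using trans[of v m w] m w insert.prems that by blast
    then show ?case using w by blast
  qed
  then show ?thesis using assms(1,2) by blast
qed

lemma dissection_simps [simp]:
  "Skel (dissection L) = block_skeleton L"
  "Tol (dissection L) = {(B, B'). is_block L B \<and> is_block L B' \<and> B \<inter> B' \<noteq> {}}"
  "Blk (dissection L) = (\<lambda>B. L\<lparr>carrier := B\<rparr>)"
  "Fil (dissection L) = (\<lambda>B B'. B \<inter> B')"
  "Phi (dissection L) = (\<lambda>B B' a. a)"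
  "Idl (dissection L) = (\<lambda>B B'. B \<inter> B')"
  by (simp_all add: dissection_def Idl_def fun_eq_iff)

text \<open>\<open>le_up\<close> says that an overlap is upward closed in the lower block and that
  the upper block respects the lower order there; \<open>le_down\<close> is the dual statement for
  the ideal in the upper block. Being tolerant is encoded as having a common element, as in a
  dissection.\<close>

locale gluing = S: lattice S for S :: "'s gorder" (structure) +
  fixes B :: "'s \<Rightarrow> 'b gorder"
  assumes S_lffc: "lffc S"
    and block_modular: "x \<in> carrier S \<Longrightarrow> modular_lattice (B x)"
    and block_complemented: "x \<in> carrier S \<Longrightarrow> complemented_lattice (B x)"
    and block_finite: "x \<in> carrier S \<Longrightarrow> finite (carrier (B x))"
    and mem_join: "\<lbrakk>x \<in> carrier S; y \<in> carrier S; a \<in> carrier (B x); a \<in> carrier (B y)\<rbrakk>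
      \<Longrightarrow> a \<in> carrier (B (x \<squnion> y))"
    and mem_meet: "\<lbrakk>x \<in> carrier S; y \<in> carrier S; a \<in> carrier (B x); a \<in> carrier (B y)\<rbrakk>
      \<Longrightarrow> a \<in> carrier (B (x \<sqinter> y))"
    and mem_between: "\<lbrakk>x \<in> carrier S; z \<in> carrier S; y \<in> carrier S; x \<sqsubseteq> z; z \<sqsubseteq> y;
      a \<in> carrier (B x); a \<in> carrier (B y)\<rbrakk> \<Longrightarrow> a \<in> carrier (B z)"
    and le_up: "\<lbrakk>x \<in> carrier S; y \<in> carrier S; x \<sqsubseteq> y; a \<in> carrier (B x); a \<in> carrier (B y);
      b \<in> carrier (B x); a \<sqsubseteq>\<^bsub>B x\<^esub> b\<rbrakk> \<Longrightarrow> b \<in> carrier (B y) \<and> a \<sqsubseteq>\<^bsub>B y\<^esub> b"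
    and le_down: "\<lbrakk>x \<in> carrier S; y \<in> carrier S; x \<sqsubseteq> y; b \<in> carrier (B x); b \<in> carrier (B y);
      a \<in> carrier (B y); a \<sqsubseteq>\<^bsub>B y\<^esub> b\<rbrakk> \<Longrightarrow> a \<in> carrier (B x) \<and> a \<sqsubseteq>\<^bsub>B x\<^esub> b"
    and meets_tolerance:
      "tolerance S {(x, y). x \<in> carrier S \<and> y \<in> carrier S \<and> carrier (B x) \<inter> carrier (B y) \<noteq> {}}"
    and cover_meets: "covers S x y \<Longrightarrow> carrier (B x) \<inter> carrier (B y) \<noteq> {}"
    and cover_not_subset: "covers S x y \<Longrightarrow>
      \<not> carrier (B x) \<subseteq> carrier (B y) \<and> \<not> carrier (B y) \<subseteq> carrier (B x)"
begin

abbreviation zero :: "'s \<Rightarrow> 'b" where "zero x \<equiv> \<bottom>\<^bsub>B x\<^esub>"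
abbreviation one :: "'s \<Rightarrow> 'b" where "one x \<equiv> \<top>\<^bsub>B x\<^esub>"

lemma S_locally_finite: "locally_finite S"
  using S_lffc by (simp add: lffc_def)

lemma block_bounded: "x \<in> carrier S \<Longrightarrow> bounded_lattice (B x)"
  using block_complemented by (simp add: complemented_lattice_def)

text \<open>Compatibility of the tolerance with joins, read with \<open>x \<squnion> x = x\<close>.
  It is needed where two chains leave \<open>x\<close> through different covers and have to be
  brought together at the join of these covers.\<close>

lemma meets_join:
  assumes "x \<in> carrier S" "y \<in> carrier S" "z \<in> carrier S"
    and "carrier (B x) \<inter> carrier (B y) \<noteq> {}" "carrier (B x) \<inter> carrier (B z) \<noteq> {}"
  shows "carrier (B x) \<inter> carrier (B (y \<squnion> z)) \<noteq> {}"
proof -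
  let ?T = "{(x, y). x \<in> carrier S \<and> y \<in> carrier S \<and> carrier (B x) \<inter> carrier (B y) \<noteq> {}}"
  have "x \<squnion> x = x" using assms(1) S.le_iff_meet by (metis S.le_refl)
  moreover have "(x, y) \<in> ?T" "(x, z) \<in> ?T" using assms by auto
  then have "(x \<squnion> x, y \<squnion> z) \<in> ?T" using meets_tolerance unfolding tolerance_def by meson
  ultimately show ?thesis by simp
qed

lemma block_refl:
  assumes "x \<in> carrier S" "a \<in> carrier (B x)" shows "a \<sqsubseteq>\<^bsub>B x\<^esub> a"
proof -
  interpret B: bounded_lattice "B x" using assms(1) by (rule block_bounded)
  show ?thesis using assms(2) by (rule B.le_refl)
qed

lemma block_trans:
  assumes "x \<in> carrier S" "a \<in> carrier (B x)" "b \<in> carrier (B x)" "c \<in> carrier (B x)"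
    and "a \<sqsubseteq>\<^bsub>B x\<^esub> b" "b \<sqsubseteq>\<^bsub>B x\<^esub> c"
  shows "a \<sqsubseteq>\<^bsub>B x\<^esub> c"
proof -
  interpret B: bounded_lattice "B x" using assms(1) by (rule block_bounded)
  show ?thesis using assms B.le_trans by blast
qed

lemma block_antisym:
  assumes "x \<in> carrier S" "a \<in> carrier (B x)" "b \<in> carrier (B x)"
    and "a \<sqsubseteq>\<^bsub>B x\<^esub> b" "b \<sqsubseteq>\<^bsub>B x\<^esub> a"
  shows "a = b"
proof -
  interpret B: bounded_lattice "B x" using assms(1) by (rule block_bounded)
  show ?thesis using assms B.le_antisym by blast
qed

lemma block_bounds:
  assumes "x \<in> carrier S"
  shows "zero x \<in> carrier (B x)" "one x \<in> carrier (B x)"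
    "\<And>a. a \<in> carrier (B x) \<Longrightarrow> zero x \<sqsubseteq>\<^bsub>B x\<^esub> a" "\<And>a. a \<in> carrier (B x) \<Longrightarrow> a \<sqsubseteq>\<^bsub>B x\<^esub> one x"
proof -
  interpret B: bounded_lattice "B x" using assms(1) by (rule block_bounded)
  show "zero x \<in> carrier (B x)" "one x \<in> carrier (B x)"
    "\<And>a. a \<in> carrier (B x) \<Longrightarrow> zero x \<sqsubseteq>\<^bsub>B x\<^esub> a" "\<And>a. a \<in> carrier (B x) \<Longrightarrow> a \<sqsubseteq>\<^bsub>B x\<^esub> one x"
    by auto
qed

lemma block_join:
  assumes "x \<in> carrier S" "a \<in> carrier (B x)" "b \<in> carrier (B x)"
  shows "a \<squnion>\<^bsub>B x\<^esub> b \<in> carrier (B x)" "a \<sqsubseteq>\<^bsub>B x\<^esub> a \<squnion>\<^bsub>B x\<^esub> b" "b \<sqsubseteq>\<^bsub>B x\<^esub> a \<squnion>\<^bsub>B x\<^esub> b"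
    "\<And>c. \<lbrakk>c \<in> carrier (B x); a \<sqsubseteq>\<^bsub>B x\<^esub> c; b \<sqsubseteq>\<^bsub>B x\<^esub> c\<rbrakk> \<Longrightarrow> a \<squnion>\<^bsub>B x\<^esub> b \<sqsubseteq>\<^bsub>B x\<^esub> c"
proof -
  interpret B: bounded_lattice "B x" using assms(1) by (rule block_bounded)
  show "a \<squnion>\<^bsub>B x\<^esub> b \<in> carrier (B x)" "a \<sqsubseteq>\<^bsub>B x\<^esub> a \<squnion>\<^bsub>B x\<^esub> b" "b \<sqsubseteq>\<^bsub>B x\<^esub> a \<squnion>\<^bsub>B x\<^esub> b"
    "\<And>c. \<lbrakk>c \<in> carrier (B x); a \<sqsubseteq>\<^bsub>B x\<^esub> c; b \<sqsubseteq>\<^bsub>B x\<^esub> c\<rbrakk> \<Longrightarrow> a \<squnion>\<^bsub>B x\<^esub> b \<sqsubseteq>\<^bsub>B x\<^esub> c"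
    using assms B.join_left B.join_right B.join_le by auto
qed

text \<open>The overlap is a nonempty ideal of the upper block, so it contains the least element of
  that block.\<close>

lemma zero_mem:
  assumes "x \<in> carrier S" "y \<in> carrier S" "x \<sqsubseteq> y" "carrier (B x) \<inter> carrier (B y) \<noteq> {}"
  shows "zero y \<in> carrier (B x)"
proof -
  obtain a where "a \<in> carrier (B x)" "a \<in> carrier (B y)" using assms by blast
  then show ?thesis using le_down[OF assms(1-3)] block_bounds(1,3)[OF assms(2)] by blast
qed

text \<open>The index of a chain may only increase, and only within the set of indices whose block
  contains the current element. This freedom makes chains composable after a shift.\<close>

inductive reach :: "'s \<Rightarrow> 'b \<Rightarrow> 's \<Rightarrow> 'b \<Rightarrow> bool" where
  reach_refl: "x \<in> carrier S \<Longrightarrow> a \<in> carrier (B x) \<Longrightarrow> reach x a x a"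
| reach_step: "\<lbrakk>reach x a y b; c \<in> carrier (B y); b \<sqsubseteq>\<^bsub>B y\<^esub> c; z \<in> carrier S; y \<sqsubseteq> z;
    c \<in> carrier (B z)\<rbrakk> \<Longrightarrow> reach x a z c"

lemma reach_mem:
  assumes "reach x a y b"
  shows "x \<in> carrier S" "y \<in> carrier S" "x \<sqsubseteq> y" "a \<in> carrier (B x)" "b \<in> carrier (B y)"
  using assms by (induction) (auto intro: S.le_trans)

lemma reach_trans: "reach y b z c \<Longrightarrow> reach x a y b \<Longrightarrow> reach x a z c"
  by (induction rule: reach.induct) (auto intro: reach_step)

lemma reach_block: "\<lbrakk>x \<in> carrier S; a \<in> carrier (B x); b \<in> carrier (B x); a \<sqsubseteq>\<^bsub>B x\<^esub> b\<rbrakk> \<Longrightarrow> reach x a x b"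
  using reach_step reach_refl by blast

lemma reach_index: "\<lbrakk>x \<in> carrier S; y \<in> carrier S; x \<sqsubseteq> y; a \<in> carrier (B x); a \<in> carrier (B y)\<rbrakk>
  \<Longrightarrow> reach x a y a"
  using reach_step reach_refl block_refl by blast

section \<open>Shifting chains along the skeleton\<close>

lemma join_mono: "\<lbrakk>x \<in> carrier S; y \<in> carrier S; w \<in> carrier S; x \<sqsubseteq> y\<rbrakk> \<Longrightarrow> x \<squnion> w \<sqsubseteq> y \<squnion> w"
  by (meson S.join_closed S.join_le S.join_left S.join_right S.le_trans)

lemma meet_mono: "\<lbrakk>x \<in> carrier S; y \<in> carrier S; w \<in> carrier S; x \<sqsubseteq> y\<rbrakk> \<Longrightarrow> x \<sqinter> w \<sqsubseteq> y \<sqinter> w"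
  by (meson S.meet_closed S.meet_le S.meet_left S.meet_right S.le_trans)

lemma join_absorb:
  assumes "y \<sqsubseteq> z" "y \<in> carrier S" "z \<in> carrier S" "w \<in> carrier S"
  shows "z \<squnion> (y \<squnion> w) = z \<squnion> w"
proof (rule S.le_antisym)
  have "y \<sqsubseteq> z \<squnion> w" using assms S.join_left S.le_trans S.join_closed by meson
  then show "z \<squnion> (y \<squnion> w) \<sqsubseteq> z \<squnion> w"
    using assms S.join_left S.join_right S.join_le S.join_closed by simp
  have "w \<sqsubseteq> z \<squnion> (y \<squnion> w)" using assms S.join_right S.le_trans S.join_closed by meson
  then show "z \<squnion> w \<sqsubseteq> z \<squnion> (y \<squnion> w)" using assms S.join_left S.join_le by simp
qed (use assms in simp_all)

lemma meet_absorb: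
  assumes "x \<sqsubseteq> y" "x \<in> carrier S" "y \<in> carrier S" "w \<in> carrier S"
  shows "x \<sqinter> (y \<sqinter> w) = x \<sqinter> w"
proof (rule S.le_antisym)
  have "x \<sqinter> w \<sqsubseteq> y" using assms S.meet_left S.le_trans S.meet_closed by meson
  then show "x \<sqinter> w \<sqsubseteq> x \<sqinter> (y \<sqinter> w)"
    using assms S.meet_left S.meet_right S.meet_le S.meet_closed by simp
  have "x \<sqinter> (y \<sqinter> w) \<sqsubseteq> w" using assms S.meet_right S.le_trans S.meet_closed by meson
  then show "x \<sqinter> (y \<sqinter> w) \<sqsubseteq> x \<sqinter> w" using assms S.meet_left S.meet_le by simp
qed (use assms in simp_all)

text \<open>The start of the chain lies in \<open>B w\<close>, and \<open>le_up\<close> carries this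
  membership forward: each move made in \<open>B y\<close> can be repeated in
  \<open>B (y \<squnion> w)\<close>.\<close>

lemma reach_shift_up:
  assumes "reach x a y b" "w \<in> carrier S" "a \<in> carrier (B w)"
  shows "reach (x \<squnion> w) a (y \<squnion> w) b"
  using assms
proof (induction)
  case (reach_refl x a)
  then show ?case by (auto intro: reach.reach_refl mem_join)
next
  case (reach_step x a y b c z)
  then have IH: "reach (x \<squnion> w) a (y \<squnion> w) b" by simp
  note y = reach_mem(2,5)[OF reach_step.hyps(1)]
  have yw: "y \<squnion> w \<in> carrier S" "b \<in> carrier (B (y \<squnion> w))" using reach_mem[OF IH] by auto
  have c: "c \<in> carrier (B (y \<squnion> w))" "b \<sqsubseteq>\<^bsub>B (y \<squnion> w)\<^esub> c"
    using le_up[OF y(1) yw(1) _ y(2) yw(2)] reach_step y S.join_left by blast+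
  have le: "y \<squnion> w \<sqsubseteq> z \<squnion> w" using reach_step y by (simp add: join_mono)
  have "(y \<squnion> w) \<squnion> (z \<squnion> w) = z \<squnion> w"
    using le yw reach_step by (simp add: S.le_iff_meet[symmetric])
  \<comment> \<open>The element \<open>c\<close> lies in \<open>B z\<close> and in
    \<open>B (y \<squnion> w)\<close>, hence in the block of the join of these indices, which is
    \<open>z \<squnion> w\<close> because \<open>y\<close> is below \<open>z\<close>.\<close>
  moreover have "c \<in> carrier (B (z \<squnion> (y \<squnion> w)))" using mem_join c yw reach_step by simp
  moreover have "z \<squnion> (y \<squnion> w) = z \<squnion> w"
    using reach_step y by (intro join_absorb)
  ultimately have "c \<in> carrier (B (z \<squnion> w))" by simp
  then show ?case using reach.reach_step[OF IH c(1) c(2) _ le] reach_step by simp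
qed

text \<open>Here the membership in \<open>B w\<close> is known at the end of the chain and travels
  backwards by \<open>le_down\<close>. The induction still peels off the last step, so
  \<open>w\<close> has to stay arbitrary.\<close>

lemma reach_shift_down:
  assumes "reach x a y b" "w \<in> carrier S" "b \<in> carrier (B w)"
  shows "reach (x \<sqinter> w) a (y \<sqinter> w) b"
  using assms
proof (induction arbitrary: w)
  case (reach_refl x a)
  then show ?case by (auto intro: reach.reach_refl mem_meet)
next
  case (reach_step x a y b c z)
  note y = reach_mem(2,5,1,3)[OF reach_step.hyps(1)]
  have yw: "y \<sqinter> w \<in> carrier S" "c \<in> carrier (B (y \<sqinter> w))"
    using y reach_step mem_meet by auto
  have b: "b \<in> carrier (B (y \<sqinter> w))" "b \<sqsubseteq>\<^bsub>B (y \<sqinter> w)\<^esub> c"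
    using le_down[OF yw(1) y(1) _ yw(2)] reach_step y S.meet_left by blast+
  \<comment> \<open>The hypothesis is used with \<open>y \<sqinter> w\<close> in place of
    \<open>w\<close>: the element \<open>b\<close> is known to lie in that block, whereas it need
    not lie in \<open>B w\<close>.\<close>
  have "reach (x \<sqinter> (y \<sqinter> w)) a (y \<sqinter> (y \<sqinter> w)) b" using reach_step.IH[OF yw(1) b(1)] .
  moreover have "x \<sqinter> (y \<sqinter> w) = x \<sqinter> w" "y \<sqinter> (y \<sqinter> w) = y \<sqinter> w"
    using y reach_step by (auto intro!: meet_absorb)
  ultimately have IH: "reach (x \<sqinter> w) a (y \<sqinter> w) b" by simp
  show ?case
    using reach.reach_step[OF IH yw(2) b(2)] reach_step y by (simp add: mem_meet meet_mono)
qed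

text \<open>Indices only rise along a chain, so a chain that ends at or below its first index never
  leaves the first block.\<close>

lemma reach_within:
  assumes "reach x a y b" "y \<sqsubseteq> x"
  shows "y = x" "a \<sqsubseteq>\<^bsub>B x\<^esub> b"
proof -
  have "y \<sqsubseteq> x \<longrightarrow> y = x \<and> a \<sqsubseteq>\<^bsub>B x\<^esub> b"
    using assms(1)
  proof (induction)
    case (reach_refl x a)
    then show ?case by (simp add: block_refl)
  next
    case (reach_step x a y b c z)
    note m = reach_mem[OF reach_step.hyps(1)]
    show ?case
    proof
      assume "z \<sqsubseteq> x"
      then have "z = x" using m reach_step S.le_trans S.le_antisym by blast
      moreover from this have "y = x" using m reach_step S.le_antisym by blast
      ultimately show "z = x \<and> a \<sqsubseteq>\<^bsub>B x\<^esub> c"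
        using reach_step m block_trans by blast
    qed
  qed
  then show "y = x" "a \<sqsubseteq>\<^bsub>B x\<^esub> b" using assms by auto
qed

section \<open>The order on the union of the blocks\<close>

definition glued_le :: "'b \<Rightarrow> 'b \<Rightarrow> bool" (infix \<open>\<preceq>\<close> 50) where
  "a \<preceq> b \<longleftrightarrow> (\<exists>x y. reach x a y b)"

lemma glued_le_block:
  "\<lbrakk>x \<in> carrier S; a \<in> carrier (B x); b \<in> carrier (B x); a \<sqsubseteq>\<^bsub>B x\<^esub> b\<rbrakk> \<Longrightarrow> a \<preceq> b"
  unfolding glued_le_def using reach_block by blast

text \<open>A chain can be started in any block through its first element: change the index from
  \<open>w\<close> to \<open>x \<squnion> w\<close>, then follow the chain shifted up by
  \<open>w\<close>. This is what makes chains composable, and transitivity follows at once.\<close>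

lemma glued_le_reach_from:
  assumes "a \<preceq> b" "w \<in> carrier S" "a \<in> carrier (B w)"
  obtains z where "reach w a z b"
proof -
  obtain x y where r: "reach x a y b" using assms glued_le_def by blast
  then have "reach (x \<squnion> w) a (y \<squnion> w) b" using reach_shift_up assms by blast
  moreover have "reach w a (x \<squnion> w) a"
    using reach_mem[OF r] assms by (auto intro!: reach_index mem_join S.join_right)
  ultimately have "reach w a (y \<squnion> w) b" by (rule reach_trans)
  then show ?thesis by (rule that)
qed

lemma glued_le_trans:
  assumes "a \<preceq> b" "b \<preceq> c" shows "a \<preceq> c"
proof -
  obtain x y where r: "reach x a y b" using assms glued_le_def by blast
  then obtain z where "reach y b z c" using glued_le_reach_from assms reach_mem by metis
  then show ?thesis using r reach_trans glued_le_def by blast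
qed

text \<open>Both chains are started at \<open>v\<close> or above and then shifted down by
  \<open>v\<close>. The second ends in an element of \<open>B v\<close>, so the shift puts
  \<open>b\<close> into \<open>B v\<close>; then the first can be shifted as well and lies wholly at
  the index \<open>v\<close>.\<close>

lemma glued_le_convex:
  assumes v: "v \<in> carrier S" "a \<in> carrier (B v)" "c \<in> carrier (B v)" and le: "a \<preceq> b" "b \<preceq> c"
  shows "b \<in> carrier (B v)" "a \<sqsubseteq>\<^bsub>B v\<^esub> b"
proof -
  obtain y where y: "reach v a y b" using glued_le_reach_from[OF le(1) v(1,2)] .
  note ym = reach_mem[OF y]
  obtain z where z: "reach y b z c" using glued_le_reach_from[OF le(2) ym(2,5)] .
  note zm = reach_mem[OF z]
  have "reach (y \<sqinter> v) b (z \<sqinter> v) c" using reach_shift_down z v by blast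
  moreover have eq: "y \<sqinter> v = v" using ym by (metis S.le_iff_join meet_comm)
  ultimately show b: "b \<in> carrier (B v)" using reach_mem by metis
  have "reach (v \<sqinter> v) a (y \<sqinter> v) b" using reach_shift_down[OF y v(1) b] .
  moreover have "v \<sqinter> v = v" using v S.le_iff_join by (metis S.le_refl)
  ultimately show "a \<sqsubseteq>\<^bsub>B v\<^esub> b" using eq reach_within v by (metis S.le_refl)
qed

lemma glued_le_refl: "x \<in> carrier S \<Longrightarrow> a \<in> carrier (B x) \<Longrightarrow> a \<preceq> a"
  using glued_le_block block_refl by blast

lemma glued_le_iff:
  assumes "v \<in> carrier S" "a \<in> carrier (B v)" "b \<in> carrier (B v)"
  shows "a \<preceq> b \<longleftrightarrow> a \<sqsubseteq>\<^bsub>B v\<^esub> b"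
  using assms glued_le_convex(2)[OF assms] glued_le_refl glued_le_block by blast

text \<open>Since \<open>b\<close> lies between \<open>a\<close> and \<open>a\<close>, convexity
  puts it into the block of \<open>a\<close>, where antisymmetry is known.\<close>

lemma glued_le_antisym:
  assumes "a \<preceq> b" "b \<preceq> a" shows "a = b"
proof -
  obtain v where v: "v \<in> carrier S" "a \<in> carrier (B v)"
    using assms(1) reach_mem(1,4) unfolding glued_le_def by metis
  then have "b \<in> carrier (B v)" using glued_le_convex assms by blast
  then show ?thesis using v assms glued_le_iff block_antisym by blast
qed

definition glued :: "'b gorder" where
  "glued = \<lparr>carrier = (\<Union>x \<in> carrier S. carrier (B x)), eq = (=), le = (\<preceq>)\<rparr>"

lemma glued_simps [simp]:
  "carrier glued = (\<Union>x \<in> carrier S. carrier (B x))" "eq glued = (=)" "le glued = (\<preceq>)"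
  by (simp_all add: glued_def)

lemma glued_partial_order: "partial_order glued"
  by unfold_locales (auto intro: glued_le_refl glued_le_trans glued_le_antisym
      dest: glued_le_antisym)

section \<open>Bounds of a block determine its index\<close>

lemma covers_S: "covers S x y \<Longrightarrow> x \<in> carrier S \<and> y \<in> carrier S \<and> x \<sqsubseteq> y \<and> x \<noteq> y"
  by (auto simp: covers_def S.lless_eq)

text \<open>If \<open>z\<close> were not below \<open>y\<close>, the least element of
  \<open>B y\<close> would also lie in the block of some cover \<open>u\<close> of \<open>y\<close>
  below \<open>y \<squnion> z\<close>. The overlap with \<open>B u\<close> is a filter of
  \<open>B y\<close>; containing the least element, it would be all of \<open>B y\<close>, which is
  excluded for covers.\<close>

lemma zero_mem_imp_le:
  assumes y: "y \<in> carrier S" and z: "z \<in> carrier S" "zero y \<in> carrier (B z)"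
  shows "z \<sqsubseteq> y"
proof (rule ccontr)
  assume "\<not> z \<sqsubseteq> y"
  then have ne: "y \<noteq> y \<squnion> z" using S.join_right y z by metis
  have yz: "y \<squnion> z \<in> carrier S" "y \<sqsubseteq> y \<squnion> z" using y z S.join_left by auto
  obtain u where u: "covers S y u" "u \<sqsubseteq> y \<squnion> z"
    using covers_upward[OF S.partial_order_axioms S_locally_finite y yz ne] .
  have "zero y \<in> carrier (B (y \<squnion> z))" using mem_join y z block_bounds by blast
  then have "zero y \<in> carrier (B u)"
    using mem_between[of y u "y \<squnion> z" "zero y"] u y yz covers_S block_bounds by blast
  then have "carrier (B y) \<subseteq> carrier (B u)"
    using le_up[of y u "zero y"] covers_S[OF u(1)] block_bounds[OF y] by blast
  then show False using cover_not_subset u by blast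
qed

lemma one_mem_imp_le:
  assumes y: "y \<in> carrier S" and z: "z \<in> carrier S" "one y \<in> carrier (B z)"
  shows "y \<sqsubseteq> z"
proof (rule ccontr)
  assume "\<not> y \<sqsubseteq> z"
  then have ne: "y \<sqinter> z \<noteq> y" using S.meet_right y z by metis
  have yz: "y \<sqinter> z \<in> carrier S" "y \<sqinter> z \<sqsubseteq> y" using y z S.meet_left by auto
  obtain u where u: "covers S u y" "y \<sqinter> z \<sqsubseteq> u"
    using covers_downward[OF S.partial_order_axioms S_locally_finite yz(1) y yz(2) ne] .
  have "one y \<in> carrier (B (y \<sqinter> z))" using mem_meet y z block_bounds by blast
  then have "one y \<in> carrier (B u)"
    using mem_between[of "y \<sqinter> z" u y "one y"] u y yz covers_S block_bounds by blast
  then have "carrier (B y) \<subseteq> carrier (B u)"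
    using le_down[of u y "one y"] covers_S[OF u(1)] block_bounds[OF y] by blast
  then show False using cover_not_subset u by blast
qed

lemma block_subset_imp_eq:
  assumes "x \<in> carrier S" "y \<in> carrier S" "carrier (B x) \<subseteq> carrier (B y)"
  shows "x = y"
proof (rule S.le_antisym)
  show "x \<sqsubseteq> y" using one_mem_imp_le[OF assms(1,2)] block_bounds(2)[OF assms(1)] assms(3) by blast
  show "y \<sqsubseteq> x" using zero_mem_imp_le[OF assms(1,2)] block_bounds(1)[OF assms(1)] assms(3) by blast
qed (fact assms)+

section \<open>Joins in a block are least upper bounds in the union\<close>

lemma card_interval_less:
  assumes "covers S x w" "w \<sqsubseteq> u" "u \<in> carrier S" "u \<sqsubseteq> z" "z \<in> carrier S"
  shows "card \<lbrace>u..z\<rbrace> < card \<lbrace>x..z\<rbrace>"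
proof (rule psubset_card_mono)
  note xw = covers_S[OF assms(1)]
  show "finite \<lbrace>x..z\<rbrace>" using S_locally_finite xw assms by (simp add: locally_finite_def)
  have xu: "x \<sqsubseteq> u" using xw assms S.le_trans by blast
  have "\<not> u \<sqsubseteq> x" using xw assms S.le_trans S.le_antisym by metis
  then have "x \<notin> \<lbrace>u..z\<rbrace>" by (auto simp: at_least_at_most_def)
  moreover have "x \<in> \<lbrace>x..z\<rbrace>"
    using xw S.le_trans[OF xu assms(4)] assms by (simp add: at_least_at_most_def)
  moreover have "\<lbrace>u..z\<rbrace> \<subseteq> \<lbrace>x..z\<rbrace>"
    using xw S.le_trans[OF xu] assms by (auto simp: at_least_at_most_def)
  ultimately show "\<lbrace>u..z\<rbrace> \<subset> \<lbrace>x..z\<rbrace>" by blast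
qed

text \<open>The size of the interval up to \<open>z\<close> serves as the induction measure. For a
  cover \<open>w\<close> of \<open>x\<close> the two blocks meet, so \<open>zero w\<close> lies in
  \<open>B x\<close>: the chain climbs to it inside \<open>B x\<close> and then changes the index to
  \<open>w\<close>.\<close>

lemma reach_zero:
  assumes "x \<in> carrier S" "z \<in> carrier S" "x \<sqsubseteq> z"
  shows "reach x (zero x) z (zero z)"
  using assms
proof (induction "card \<lbrace>x..z\<rbrace>" arbitrary: x rule: less_induct)
  case less
  show ?case
  proof (cases "x = z")
    case True
    then show ?thesis using less.prems reach_refl block_bounds by blast
  next
    case False
    obtain w where w: "covers S x w" "w \<sqsubseteq> z"
      using covers_upward[OF S.partial_order_axioms S_locally_finite less.prems False] .
    note xw = covers_S[OF w(1)]
    have "reach w (zero w) z (zero z)"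
      using less.hyps[of w] card_interval_less[OF w(1) S.le_refl _ w(2)] xw w less.prems by blast
    moreover have "zero w \<in> carrier (B x)" using zero_mem xw cover_meets w by blast
    then have "reach x (zero x) x (zero w)" "reach x (zero w) w (zero w)"
      using xw block_bounds by (auto intro: reach_block reach_index)
    ultimately show ?thesis using reach_trans by blast
  qed
qed

text \<open>This matches the skeleton with the order by least elements used for the blocks of a
  dissection. A chain from \<open>zero x\<close> started at \<open>x\<close> ends at an index above
  \<open>x\<close> whose block contains \<open>zero y\<close>, and such an index is below
  \<open>y\<close>.\<close>

lemma zero_le_zero_iff:
  assumes "x \<in> carrier S" "y \<in> carrier S"
  shows "zero x \<preceq> zero y \<longleftrightarrow> x \<sqsubseteq> y"
proof
  assume "zero x \<preceq> zero y"
  then obtain z where z: "reach x (zero x) z (zero y)"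
    using glued_le_reach_from assms block_bounds by metis
  note m = reach_mem[OF z]
  then have "z \<sqsubseteq> y" using zero_mem_imp_le assms by blast
  then show "x \<sqsubseteq> y" using S.le_trans m assms by blast
qed (use assms reach_zero glued_le_def in blast)

text \<open>Chains grow at their upper end, whereas the induction for joins consumes them from the
  lower end, one cover at a time. The normal form obtained here stays in \<open>B x\<close> up to an
  element \<open>b\<close> and then passes to a cover of \<open>x\<close>.\<close>

lemma reach_first_step:
  assumes "reach x a z c" "x \<noteq> z"
  obtains w b where "covers S x w" "w \<sqsubseteq> z" "b \<in> carrier (B x)" "b \<in> carrier (B w)"
    "a \<sqsubseteq>\<^bsub>B x\<^esub> b" "reach w b z c"
proof -
  have "x \<noteq> z \<longrightarrow> (\<exists>w b. covers S x w \<and> w \<sqsubseteq> z \<and> b \<in> carrier (B x) \<and> b \<in> carrier (B w)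
    \<and> a \<sqsubseteq>\<^bsub>B x\<^esub> b \<and> reach w b z c)"
    using assms(1)
  proof (induction)
    case (reach_step x a y b c z)
    note m = reach_mem[OF reach_step.hyps(1)]
    show ?case
    proof (cases "x = y")
      case False
      then obtain w e where w: "covers S x w" "w \<sqsubseteq> y" "e \<in> carrier (B x)" "e \<in> carrier (B w)"
        "a \<sqsubseteq>\<^bsub>B x\<^esub> e" "reach w e y b" using reach_step.IH by blast
      have "w \<sqsubseteq> z" using w m covers_S[OF w(1)] reach_step S.le_trans by blast
      moreover have "reach w e z c" using w(6) reach_step.hyps by (metis reach.reach_step)
      ultimately show ?thesis using w by blast
    next
      case True
      have ab: "a \<sqsubseteq>\<^bsub>B x\<^esub> b" using reach_within[of x a x b] reach_step.hyps(1) True m by auto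
      have ac: "a \<sqsubseteq>\<^bsub>B x\<^esub> c"
        using block_trans[OF m(1,4) _ _ ab] m reach_step True by auto
      show ?thesis
      proof
        assume "x \<noteq> z"
        moreover have xz: "x \<sqsubseteq> z" using True reach_step by simp
        ultimately obtain w where w: "covers S x w" "w \<sqsubseteq> z"
          using covers_upward[OF S.partial_order_axioms S_locally_finite m(1) reach_step.hyps(4)]
          by blast
        note xw = covers_S[OF w(1)]
        \<comment> \<open>As long as the chain has stayed in \<open>B x\<close>, its current element
          \<open>c\<close> lies in \<open>B x\<close> and \<open>B z\<close>, hence in every block
          between; the chain can leave through any cover \<open>w\<close> below \<open>z\<close>,
          with \<open>c\<close> itself as the transfer point.\<close>
        have "c \<in> carrier (B w)"
          using mem_between[of x w z c] xw w reach_step True by blast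
        moreover from this have "reach w c z c" using reach_index xw w reach_step by blast
        ultimately show "\<exists>w b. covers S x w \<and> w \<sqsubseteq> z \<and> b \<in> carrier (B x) \<and> b \<in> carrier (B w)
          \<and> a \<sqsubseteq>\<^bsub>B x\<^esub> b \<and> reach w b z c" using w ac reach_step True by blast
      qed
    qed
  qed simp
  then show ?thesis using assms that by blast
qed

text \<open>The join in \<open>B x\<close> is carried into \<open>B y\<close> by
  \<open>le_up\<close>, so it bounds the join in \<open>B y\<close> from above;
  \<open>le_down\<close> then brings the latter into \<open>B x\<close>.\<close>

lemma join_mem_lower:
  assumes xy: "x \<in> carrier S" "y \<in> carrier S" "x \<sqsubseteq> y"
    and a: "a \<in> carrier (B x)" "a \<in> carrier (B y)" and b: "b \<in> carrier (B x)" "b \<in> carrier (B y)"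
  shows "a \<squnion>\<^bsub>B y\<^esub> b \<in> carrier (B x)" "a \<sqsubseteq>\<^bsub>B x\<^esub> a \<squnion>\<^bsub>B y\<^esub> b" "b \<sqsubseteq>\<^bsub>B x\<^esub> a \<squnion>\<^bsub>B y\<^esub> b"
proof -
  let ?s = "a \<squnion>\<^bsub>B x\<^esub> b"
  note jx = block_join[OF xy(1) a(1) b(1)] and jy = block_join[OF xy(2) a(2) b(2)]
  have s: "?s \<in> carrier (B y)" "a \<sqsubseteq>\<^bsub>B y\<^esub> ?s" "b \<sqsubseteq>\<^bsub>B y\<^esub> ?s"
    using le_up[OF xy a jx(1,2)] le_up[OF xy b jx(1,3)] by blast+
  then show m: "a \<squnion>\<^bsub>B y\<^esub> b \<in> carrier (B x)"
    using le_down[OF xy jx(1) s(1) jy(1) jy(4)[OF s]] by blast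
  show "a \<sqsubseteq>\<^bsub>B x\<^esub> a \<squnion>\<^bsub>B y\<^esub> b" "b \<sqsubseteq>\<^bsub>B x\<^esub> a \<squnion>\<^bsub>B y\<^esub> b"
    using le_down[OF xy m jy(1) a(2) jy(2)] le_down[OF xy m jy(1) b(2) jy(3)] by blast+
qed

text \<open>Joining with \<open>zero t\<close> is the cheapest way into \<open>B t\<close>, whose
  overlap with \<open>B w\<close> is a filter of \<open>B w\<close> containing
  \<open>zero t\<close>. The result stays in \<open>B x\<close>, because both joinands lie in the
  ideal that \<open>B x\<close> cuts out of \<open>B w\<close>.\<close>

lemma reach_raise_to:
  assumes x: "x \<in> carrier S" and w: "covers S x w" "w \<sqsubseteq> t" and t: "t \<in> carrier S" "t \<sqsubseteq> z"
    and zt: "zero t \<in> carrier (B x)"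
    and b: "b \<in> carrier (B x)" "b \<in> carrier (B w)"
    and r: "reach w (b \<squnion>\<^bsub>B w\<^esub> zero t) z c"
  obtains e where "e \<in> carrier (B x)" "e \<in> carrier (B t)" "b \<sqsubseteq>\<^bsub>B x\<^esub> e" "reach t e z c"
proof -
  let ?e = "b \<squnion>\<^bsub>B w\<^esub> zero t"
  note xw = covers_S[OF w(1)] and m = reach_mem[OF r]
  have ztt: "zero t \<in> carrier (B t)" using t block_bounds by blast
  have ztw: "zero t \<in> carrier (B w)"
    using mem_between[of x w t "zero t"] xw w t zt ztt by blast
  note j = join_mem_lower[of x w b "zero t"] and jw = block_join[OF _ b(2) ztw]
  have et: "?e \<in> carrier (B t)"
    using le_up[of w t "zero t" ?e] xw w t jw ztt ztw by blast
  have "reach (w \<squnion> t) ?e (z \<squnion> t) c" using reach_shift_up[OF r t(1) et] .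
  moreover have "w \<squnion> t = t" "z \<squnion> t = z"
    using w t m S.le_iff_meet[of w t] S.le_iff_meet[of t z] join_comm by metis+
  ultimately have "reach t ?e z c" by simp
  then show ?thesis using that[of ?e] j xw b ztw zt et by blast
qed

text \<open>A diamond argument. The two chains leave \<open>B x\<close> through covers
  \<open>v\<close> and \<open>w\<close>; both exits are raised into the block of
  \<open>t = v \<squnion> w\<close> by joining them with \<open>zero t\<close>, and are joined with
  each other there. The induction hypothesis is applied at \<open>v\<close>, at \<open>w\<close> and
  at \<open>t\<close>, each giving a shorter interval.\<close>

lemma reach_join:
  assumes "reach x a z c" "reach x b z c"
  shows "reach x (a \<squnion>\<^bsub>B x\<^esub> b) z c"
  using assms
proof (induction "card \<lbrace>x..z\<rbrace>" arbitrary: x a b rule: less_induct)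
  case less
  note ma = reach_mem[OF less.prems(1)] and mb = reach_mem[OF less.prems(2)]
  note j = block_join[OF ma(1,4) mb(4)]
  show ?case
  proof (cases "x = z")
    case True
    then have "a \<sqsubseteq>\<^bsub>B x\<^esub> c" "b \<sqsubseteq>\<^bsub>B x\<^esub> c"
      using reach_within less.prems ma S.le_refl by blast+
    then have "reach x (a \<squnion>\<^bsub>B x\<^esub> b) x c"
      using j(4)[of c] ma j(1) True by (intro reach_block) simp_all
    then show ?thesis using True by simp
  next
    case False
    obtain v d where v: "covers S x v" "v \<sqsubseteq> z" "d \<in> carrier (B x)" "d \<in> carrier (B v)"
      "a \<sqsubseteq>\<^bsub>B x\<^esub> d" "reach v d z c" using reach_first_step[OF less.prems(1) False] .
    obtain w e where w: "covers S x w" "w \<sqsubseteq> z" "e \<in> carrier (B x)" "e \<in> carrier (B w)"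
      "b \<sqsubseteq>\<^bsub>B x\<^esub> e" "reach w e z c" using reach_first_step[OF less.prems(2) False] .
    note xv = covers_S[OF v(1)] and xw = covers_S[OF w(1)]
    define t where "t = v \<squnion> w"
    have t: "t \<in> carrier S" "v \<sqsubseteq> t" "w \<sqsubseteq> t" "t \<sqsubseteq> z"
      using xv xw v w ma S.join_left S.join_right S.join_le by (auto simp: t_def)
    have xt: "x \<sqsubseteq> t" using S.le_trans xv t by blast
    \<comment> \<open>The blocks of the covers meet \<open>B x\<close>, so by the tolerance the
      block of their join does too. This brings \<open>zero t\<close> into
      \<open>B x\<close>.\<close>
    have meets: "carrier (B x) \<inter> carrier (B t) \<noteq> {}"
      unfolding t_def
      using ma(1) _ _ cover_meets[OF v(1)] cover_meets[OF w(1)] by (rule meets_join) (use xv xw in simp_all)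
    have zt: "zero t \<in> carrier (B x)" by (rule zero_mem[OF ma(1) t(1) xt meets])
    have ztt: "zero t \<in> carrier (B t)" using t block_bounds by blast
    \<comment> \<open>Since \<open>t\<close> is below \<open>z\<close>, \<open>zero t\<close>
      reaches \<open>zero z\<close> and from there \<open>c\<close>, so adjoining
      \<open>zero t\<close> does not spoil the bound \<open>c\<close>.\<close>
    have rt: "reach t (zero t) z c"
      using reach_trans[OF reach_block[OF ma(2) block_bounds(1)[OF ma(2)] ma(5)] reach_zero]
        block_bounds(3)[OF ma(2,5)] t(1,4) ma(2) by blast
    have up: "\<exists>e' \<in> carrier (B x) \<inter> carrier (B t). e \<sqsubseteq>\<^bsub>B x\<^esub> e' \<and> reach t e' z c"
      if w: "covers S x w" "w \<sqsubseteq> z" "e \<in> carrier (B x)" "e \<in> carrier (B w)" "reach w e z c" "w \<sqsubseteq> t"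
      for w e
    proof -
      note xw = covers_S[OF w(1)]
      have "zero t \<in> carrier (B w)"
        using mem_between[of x w t "zero t"] xw w t zt ztt by blast
      then have "reach w (zero t) t (zero t)" using xw w(6) t(1) ztt by (intro reach_index) blast+
      then have "reach w (zero t) z c" by (rule reach_trans[OF rt])
      moreover have "card \<lbrace>w..z\<rbrace> < card \<lbrace>x..z\<rbrace>"
        using card_interval_less[OF w(1) S.le_refl _ w(2) ma(2)] xw by blast
      ultimately have "reach w (e \<squnion>\<^bsub>B w\<^esub> zero t) z c"
        using w(5) by (intro less.hyps)
      from reach_raise_to[OF ma(1) w(1,6) t(1,4) zt w(3,4) this] show ?thesis by blast
    qed
    obtain d' where d': "d' \<in> carrier (B x)" "d' \<in> carrier (B t)" "d \<sqsubseteq>\<^bsub>B x\<^esub> d'" "reach t d' z c"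
      using up[OF v(1-4,6) t(2)] by blast
    obtain e' where e': "e' \<in> carrier (B x)" "e' \<in> carrier (B t)" "e \<sqsubseteq>\<^bsub>B x\<^esub> e'" "reach t e' z c"
      using up[OF w(1-4,6) t(3)] by blast
    let ?s = "d' \<squnion>\<^bsub>B t\<^esub> e'"
    note s = join_mem_lower[OF ma(1) t(1) xt d'(1,2) e'(1,2)]
    have "a \<sqsubseteq>\<^bsub>B x\<^esub> d'" "b \<sqsubseteq>\<^bsub>B x\<^esub> e'"
      using block_trans[OF ma(1,4) v(3) d'(1) v(5) d'(3)]
        block_trans[OF ma(1) mb(4) w(3) e'(1) w(5) e'(3)] .
    then have "a \<sqsubseteq>\<^bsub>B x\<^esub> ?s" "b \<sqsubseteq>\<^bsub>B x\<^esub> ?s"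
      using block_trans[OF ma(1,4) d'(1) s(1) _ s(2)] block_trans[OF ma(1) mb(4) e'(1) s(1) _ s(3)]
      by blast+
    then have "reach x (a \<squnion>\<^bsub>B x\<^esub> b) x ?s" using j s ma by (intro reach_block) simp_all
    moreover have "reach x ?s t ?s" using ma(1) t xt s block_join d' e' by (intro reach_index)
    moreover have "reach t ?s z c"
      using card_interval_less[OF v(1) t(2,1,4) ma(2)] d'(4) e'(4) by (rule less.hyps)
    ultimately show ?thesis using reach_trans by blast
  qed
qed

text \<open>The two chains may end at different indices \<open>y\<close> and \<open>z\<close>. Both
  blocks contain \<open>c\<close>, so both chains can be prolonged to the common index
  \<open>y \<squnion> z\<close>.\<close>

lemma glued_join_le:
  assumes x: "x \<in> carrier S" "a \<in> carrier (B x)" "b \<in> carrier (B x)" and "a \<preceq> c" "b \<preceq> c"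
  shows "a \<squnion>\<^bsub>B x\<^esub> b \<preceq> c"
proof -
  obtain y where y: "reach x a y c" using glued_le_reach_from[OF assms(4) x(1,2)] .
  obtain z where z: "reach x b z c" using glued_le_reach_from[OF assms(5) x(1,3)] .
  note ym = reach_mem[OF y] and zm = reach_mem[OF z]
  have "c \<in> carrier (B (y \<squnion> z))" using mem_join ym zm by blast
  then have "reach y c (y \<squnion> z) c" "reach z c (y \<squnion> z) c"
    using ym zm S.join_left S.join_right by (auto intro!: reach_index)
  then have "reach x a (y \<squnion> z) c" "reach x b (y \<squnion> z) c" using reach_trans y z by blast+
  then show ?thesis using reach_join glued_le_def by blast
qed

section \<open>Complemented intervals lie in blocks\<close>

lemma reach_leaves:
  assumes "reach x a z c" "c \<noteq> a"
  obtains y e where "y \<in> carrier S" "x \<sqsubseteq> y" "a \<in> carrier (B y)" "e \<in> carrier (B y)" "e \<noteq> a"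
    "a \<preceq> e" "e \<preceq> c"
proof -
  have "c \<noteq> a \<longrightarrow> (\<exists>y e. y \<in> carrier S \<and> x \<sqsubseteq> y \<and> a \<in> carrier (B y) \<and> e \<in> carrier (B y)
    \<and> e \<noteq> a \<and> a \<preceq> e \<and> e \<preceq> c)"
    using assms(1)
  proof (induction)
    case (reach_step x a y b c z)
    note m = reach_mem[OF reach_step.hyps(1)]
    have bc: "b \<preceq> c" using glued_le_block[OF m(2,5)] reach_step by blast
    have cc: "c \<preceq> c" using glued_le_refl[OF m(2)] reach_step by blast
    show ?case
    \<comment> \<open>If \<open>b = a\<close>, the current step is the first that can move away from
      \<open>a\<close>. It takes place in \<open>B y\<close>, which contains \<open>a\<close>
      although its index may already have risen above \<open>x\<close>.\<close>
    proof (cases "b = a")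
      case True
      then show ?thesis using m bc cc reach_step by blast
    next
      case False
      then show ?thesis using reach_step.IH bc glued_le_trans by blast
    qed
  qed simp
  then show ?thesis using that assms(2) by blast
qed

lemma greatest_index:
  assumes x0: "x0 \<in> carrier S" "a \<in> carrier (B x0)"
  obtains x where "x \<in> carrier S" "a \<in> carrier (B x)"
    "\<And>y. \<lbrakk>y \<in> carrier S; x \<sqsubseteq> y; a \<in> carrier (B y)\<rbrakk> \<Longrightarrow> y = x"
proof -
  let ?T = "{x \<in> carrier S. x0 \<sqsubseteq> x \<and> a \<in> carrier (B x)}"
  \<comment> \<open>Finiteness of \<open>?T\<close> comes from the finite block \<open>B x0\<close>:
    all least elements of the blocks in question lie in it, and a least element determines its
    index.\<close>
  have "zero ` ?T \<subseteq> carrier (B x0)" using zero_mem[OF x0(1)] x0(2) by blast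
  moreover have "inj_on zero ?T"
  proof (rule inj_onI)
    fix x y assume xy: "x \<in> ?T" "y \<in> ?T" "zero x = zero y"
    then have x: "x \<in> carrier S" and y: "y \<in> carrier S" by auto
    have "y \<sqsubseteq> x" using zero_mem_imp_le[OF x y] block_bounds(1)[OF y] xy(3) by simp
    moreover have "x \<sqsubseteq> y" using zero_mem_imp_le[OF y x] block_bounds(1)[OF x] xy(3) by simp
    ultimately show "x = y" using S.le_antisym x y by blast
  qed
  ultimately have fin: "finite ?T"
    using finite_subset[OF _ block_finite[OF x0(1)]] finite_imageD by blast
  have "\<exists>w \<in> ?T. u \<sqsubseteq> w \<and> v \<sqsubseteq> w" if "u \<in> ?T" "v \<in> ?T" for u v
  proof
    have u: "u \<in> carrier S" "x0 \<sqsubseteq> u" and v: "v \<in> carrier S" using that by auto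
    have "x0 \<sqsubseteq> u \<squnion> v" using S.le_trans[OF u(2) S.join_left[OF u(1) v]] x0 u v by simp
    moreover have "a \<in> carrier (B (u \<squnion> v))" using that by (intro mem_join) simp_all
    ultimately show "u \<squnion> v \<in> ?T" using u v by simp
    show "u \<sqsubseteq> u \<squnion> v \<and> v \<sqsubseteq> u \<squnion> v" using u v S.join_left S.join_right by blast
  qed
  moreover have "?T \<noteq> {}" using x0 by blast
  moreover have "u \<sqsubseteq> w" if "u \<in> ?T" "v \<in> ?T" "w \<in> ?T" "u \<sqsubseteq> v" "v \<sqsubseteq> w" for u v w
    using that S.le_trans by blast
  ultimately obtain x where x: "x \<in> ?T" "\<forall>u \<in> ?T. u \<sqsubseteq> x"
    using finite_directed_has_greatest[OF fin, of "(\<sqsubseteq>)"] by blast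
  have "y = x" if y: "y \<in> carrier S" "x \<sqsubseteq> y" "a \<in> carrier (B y)" for y
  proof (rule S.le_antisym)
    have "x0 \<sqsubseteq> y" using S.le_trans[of x0 x y] x(1) y x0 by simp
    then show "y \<sqsubseteq> x" using x(2) y by simp
  qed (use x(1) y in simp_all)
  then show ?thesis using that[of x] x(1) by blast
qed

lemma block_interval:
  assumes x: "x \<in> carrier S"
  shows "carrier (B x) = \<lbrace>zero x..one x\<rbrace>\<^bsub>glued\<^esub>"
proof
  note b = block_bounds[OF x]
  show "carrier (B x) \<subseteq> \<lbrace>zero x..one x\<rbrace>\<^bsub>glued\<^esub>"
    using x b glued_le_block[OF x] by (auto simp: at_least_at_most_def)
  show "\<lbrace>zero x..one x\<rbrace>\<^bsub>glued\<^esub> \<subseteq> carrier (B x)"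
    using glued_le_convex(1)[OF x b(1,2)] by (auto simp: at_least_at_most_def)
qed

abbreviation restricted :: "'b set \<Rightarrow> 'b gorder" where
  "restricted A \<equiv> glued\<lparr>carrier := A\<rparr>"

lemma block_iso:
  assumes "x \<in> carrier S"
  shows "order_isomorphism (B x) (restricted (carrier (B x))) id"
proof -
  interpret B: bounded_lattice "B x" using assms by (rule block_bounded)
  show ?thesis
    by unfold_locales (use glued_le_iff[OF assms] in auto)
qed

lemma restricted_simps [simp]:
  "carrier (restricted A) = A" "eq (restricted A) = (=)" "le (restricted A) = (\<preceq>)"
  by simp_all

lemma complemented_interval_block:
  assumes x: "x \<in> carrier S"
  shows "complemented_interval glued (carrier (B x))"
  unfolding complemented_interval_def
proof
  note b = block_bounds[OF x]
  have "zero x \<sqsubseteq>\<^bsub>glued\<^esub> one x" using glued_le_block[OF x b(1,2) b(3)[OF b(2)]] by simp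
  then show "\<exists>a \<in> carrier glued. \<exists>c \<in> carrier glued. a \<sqsubseteq>\<^bsub>glued\<^esub> c \<and> carrier (B x) = \<lbrace>a..c\<rbrace>\<^bsub>glued\<^esub>"
    using x b(1,2) block_interval[OF x] by (intro bexI[of _ "zero x"] bexI[of _ "one x"]) auto
  show "complemented_lattice (restricted (carrier (B x)))"
    using order_isomorphism.complemented_target[OF block_iso[OF x] block_complemented[OF x]] .
qed

text \<open>Let \<open>[a, b]\<close> be complemented, let \<open>x\<close> be the greatest index of a block through \<open>a\<close> and \<open>j\<close>
  the greatest element of that block below \<open>b\<close>. Every element of \<open>[a, b]\<close> other than \<open>a\<close> lies above
  an element of the block other than \<open>a\<close>, so a complement of \<open>j\<close> can only be \<open>a\<close>, whence \<open>j = b\<close>.\<close>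

lemma complemented_interval_subset_block:
  assumes "complemented_interval glued A"
  obtains x where "x \<in> carrier S" "A \<subseteq> carrier (B x)"
proof -
  obtain a b where ab: "a \<in> carrier glued" "b \<in> carrier glued" "a \<preceq> b"
    and A: "A = \<lbrace>a..b\<rbrace>\<^bsub>glued\<^esub>" and compl: "complemented_lattice (restricted A)"
    using assms unfolding complemented_interval_def by auto
  have memA: "u \<in> A \<longleftrightarrow> u \<in> carrier glued \<and> a \<preceq> u \<and> u \<preceq> b" for u
    unfolding A by (simp add: at_least_at_most_def)
  have "a \<preceq> a" "b \<preceq> b" using ab(1,2) glued_le_refl by auto
  then have aA: "a \<in> A" and bA: "b \<in> A" using ab memA by simp_all
  interpret K: bounded_lattice "restricted A"
    using compl by (simp add: complemented_lattice_def)
  have bot: "\<bottom>\<^bsub>restricted A\<^esub> = a" using K.bottom_eq[of a] aA memA by simp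
  have top: "\<top>\<^bsub>restricted A\<^esub> = b" using K.top_eq[of b] bA memA by simp
  obtain x0 where "x0 \<in> carrier S" "a \<in> carrier (B x0)" using ab(1) by auto
  then obtain x where x: "x \<in> carrier S" "a \<in> carrier (B x)"
    and greatest: "\<And>y. \<lbrakk>y \<in> carrier S; x \<sqsubseteq> y; a \<in> carrier (B y)\<rbrakk> \<Longrightarrow> y = x"
    using greatest_index by blast
  let ?D = "carrier (B x) \<inter> A"
  have "\<exists>w \<in> ?D. u \<preceq> w \<and> v \<preceq> w" if uv: "u \<in> ?D" "v \<in> ?D" for u v
  proof
    have u: "u \<in> carrier (B x)" "a \<preceq> u" "u \<preceq> b" and v: "v \<in> carrier (B x)" "a \<preceq> v" "v \<preceq> b"
      using uv memA by auto
    note j = block_join[OF x(1) u(1) v(1)]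
    show le: "u \<preceq> u \<squnion>\<^bsub>B x\<^esub> v \<and> v \<preceq> u \<squnion>\<^bsub>B x\<^esub> v"
      using glued_le_block[OF x(1)] u(1) v(1) j by blast
    have "a \<preceq> u \<squnion>\<^bsub>B x\<^esub> v" using glued_le_trans u(2) le by blast
    \<comment> \<open>The bound \<open>b\<close> may lie far outside the block, so this needs the
      join of the block to be a least upper bound in the whole union.\<close>
    moreover have "u \<squnion>\<^bsub>B x\<^esub> v \<preceq> b" by (rule glued_join_le[OF x(1) u(1) v(1) u(3) v(3)])
    ultimately show "u \<squnion>\<^bsub>B x\<^esub> v \<in> ?D" using x(1) j(1) memA by auto
  qed
  moreover have "finite ?D" "?D \<noteq> {}" using block_finite[OF x(1)] x(2) aA by blast+
  ultimately obtain j where j: "j \<in> carrier (B x)" "j \<in> A" and j_max: "\<forall>u \<in> ?D. u \<preceq> j"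
    using finite_directed_has_greatest[of ?D "(\<preceq>)"] glued_le_trans by blast
  obtain k where k: "k \<in> A" "j \<sqinter>\<^bsub>restricted A\<^esub> k = a" "j \<squnion>\<^bsub>restricted A\<^esub> k = b"
    using compl j(2) bot top unfolding complemented_lattice_def restricted_simps by metis
  have "k = a"
  proof (rule ccontr)
    assume "k \<noteq> a"
    have "a \<preceq> k" using k memA by blast
    then obtain z where "reach x a z k" using glued_le_reach_from[OF _ x] by blast
    then obtain y e where y: "y \<in> carrier S" "x \<sqsubseteq> y" "a \<in> carrier (B y)" "e \<in> carrier (B y)"
      and e: "e \<noteq> a" "a \<preceq> e" "e \<preceq> k"
      using reach_leaves[OF _ \<open>k \<noteq> a\<close>] by metis
    have "e \<in> carrier (B x)" using greatest[OF y(1-3)] y(4) by simp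
    moreover have "e \<preceq> b" using e(3) k(1) memA glued_le_trans by blast
    ultimately have "e \<in> ?D" using x(1) e(2) memA by auto
    then have "e \<preceq> j" "e \<in> A" using j_max by auto
    then have "e \<sqsubseteq>\<^bsub>restricted A\<^esub> j \<sqinter>\<^bsub>restricted A\<^esub> k"
      using e(3) j(2) k(1) by (intro K.meet_le) simp_all
    then have "e \<preceq> a" unfolding k(2) by simp
    then show False using e glued_le_antisym by blast
  qed
  have "j \<squnion>\<^bsub>restricted A\<^esub> k \<sqsubseteq>\<^bsub>restricted A\<^esub> j"
    using j(2) k(1) K.le_refl[of j] memA unfolding \<open>k = a\<close> by (intro K.join_le) simp_all
  then have "b \<preceq> j" unfolding k(3) by simp
  then have "b = j" using j(2) memA glued_le_antisym by blast
  then have "A \<subseteq> carrier (B x)" using glued_le_convex(1)[OF x, of b] j memA by blast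
  then show ?thesis using that x(1) by blast
qed

section \<open>Blocks and skeleton of the union\<close>

lemma is_block_glued_iff: "is_block glued A \<longleftrightarrow> (\<exists>x \<in> carrier S. A = carrier (B x))"
proof
  assume A: "is_block glued A"
  then obtain x where x: "x \<in> carrier S" "A \<subseteq> carrier (B x)"
    using complemented_interval_subset_block unfolding is_block_def by blast
  then have "carrier (B x) = A"
    using A complemented_interval_block[OF x(1)] unfolding is_block_def by blast
  then show "\<exists>x \<in> carrier S. A = carrier (B x)" using x(1) by blast
next
  assume "\<exists>x \<in> carrier S. A = carrier (B x)"
  then obtain x where x: "x \<in> carrier S" "A = carrier (B x)" by blast
  have "A' = A" if A': "complemented_interval glued A'" "A \<subseteq> A'" for A'
  proof -
    obtain y where y: "y \<in> carrier S" "A' \<subseteq> carrier (B y)"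
      using complemented_interval_subset_block[OF A'(1)] .
    then have "x = y" using block_subset_imp_eq[OF x(1) y(1)] A'(2) x(2) by simp
    then show ?thesis using A'(2) x(2) y(2) by simp
  qed
  then show "is_block glued A" using complemented_interval_block x unfolding is_block_def by blast
qed

lemma Collect_is_block: "{A. is_block glued A} = (\<lambda>x. carrier (B x)) ` carrier S"
  using is_block_glued_iff by blast

lemma restricted_bottom:
  assumes "x \<in> carrier S" shows "\<bottom>\<^bsub>restricted (carrier (B x))\<^esub> = zero x"
  using order_isomorphism.bottom_image[OF block_iso[OF assms] block_bounded[OF assms]] by simp

lemma skeleton_iso: "order_isomorphism S (block_skeleton glued) (\<lambda>x. carrier (B x))"
proof unfold_locales
  show "bij_betw (\<lambda>x. carrier (B x)) (carrier S) (carrier (block_skeleton glued))"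
    unfolding bij_betw_def inj_on_def
    using block_subset_imp_eq Collect_is_block by (simp add: block_skeleton_def)
qed (simp_all add: block_skeleton_def restricted_bottom zero_le_zero_iff)

section \<open>Overlaps of blocks as filters, ideals and lattices\<close>

lemma block_meet:
  assumes "x \<in> carrier S" "a \<in> carrier (B x)" "b \<in> carrier (B x)"
  shows "a \<sqinter>\<^bsub>B x\<^esub> b \<in> carrier (B x)" "a \<sqinter>\<^bsub>B x\<^esub> b \<sqsubseteq>\<^bsub>B x\<^esub> a" "a \<sqinter>\<^bsub>B x\<^esub> b \<sqsubseteq>\<^bsub>B x\<^esub> b"
    "\<And>c. \<lbrakk>c \<in> carrier (B x); c \<sqsubseteq>\<^bsub>B x\<^esub> a; c \<sqsubseteq>\<^bsub>B x\<^esub> b\<rbrakk> \<Longrightarrow> c \<sqsubseteq>\<^bsub>B x\<^esub> a \<sqinter>\<^bsub>B x\<^esub> b"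
proof -
  interpret B: bounded_lattice "B x" using assms(1) by (rule block_bounded)
  show "a \<sqinter>\<^bsub>B x\<^esub> b \<in> carrier (B x)" "a \<sqinter>\<^bsub>B x\<^esub> b \<sqsubseteq>\<^bsub>B x\<^esub> a" "a \<sqinter>\<^bsub>B x\<^esub> b \<sqsubseteq>\<^bsub>B x\<^esub> b"
    "\<And>c. \<lbrakk>c \<in> carrier (B x); c \<sqsubseteq>\<^bsub>B x\<^esub> a; c \<sqsubseteq>\<^bsub>B x\<^esub> b\<rbrakk> \<Longrightarrow> c \<sqsubseteq>\<^bsub>B x\<^esub> a \<sqinter>\<^bsub>B x\<^esub> b"
    using assms B.meet_left B.meet_right B.meet_le by auto
qed

lemma restricted_meet:
  assumes "x \<in> carrier S" "a \<in> carrier (B x)" "b \<in> carrier (B x)"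
  shows "a \<sqinter>\<^bsub>restricted (carrier (B x))\<^esub> b = a \<sqinter>\<^bsub>B x\<^esub> b"
proof -
  interpret B: bounded_lattice "B x" using assms(1) by (rule block_bounded)
  show ?thesis
    using order_isomorphism.meet_image[OF block_iso[OF assms(1)] B.lattice_axioms assms(2,3)] by simp
qed

lemma restricted_join:
  assumes "x \<in> carrier S" "a \<in> carrier (B x)" "b \<in> carrier (B x)"
  shows "a \<squnion>\<^bsub>restricted (carrier (B x))\<^esub> b = a \<squnion>\<^bsub>B x\<^esub> b"
proof -
  interpret B: bounded_lattice "B x" using assms(1) by (rule block_bounded)
  show ?thesis
    using order_isomorphism.join_image[OF block_iso[OF assms(1)] B.lattice_axioms assms(2,3)] by simp
qed

lemma meet_mem_upper:
  assumes xy: "x \<in> carrier S" "y \<in> carrier S" "x \<sqsubseteq> y"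
    and a: "a \<in> carrier (B x)" "a \<in> carrier (B y)" and b: "b \<in> carrier (B x)" "b \<in> carrier (B y)"
  shows "a \<sqinter>\<^bsub>B x\<^esub> b \<in> carrier (B y)"
proof -
  let ?s = "a \<sqinter>\<^bsub>B y\<^esub> b"
  note mx = block_meet[OF xy(1) a(1) b(1)] and my = block_meet[OF xy(2) a(2) b(2)]
  have s: "?s \<in> carrier (B x)" "?s \<sqsubseteq>\<^bsub>B x\<^esub> a" "?s \<sqsubseteq>\<^bsub>B x\<^esub> b"
    using le_down[OF xy a my(1,2)] le_down[OF xy b my(1,3)] by blast+
  then show ?thesis using le_up[OF xy s(1) my(1) mx(1) mx(4)[OF s]] by blast
qed

text \<open>\<open>lattice_iso\<close> presupposes lattices, so the identity on an overlap calls for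
  this. The join is taken from the upper block, in which the overlap is an ideal, and the meet from
  the lower block, in which it is a filter.\<close>

lemma lattice_inter:
  assumes xy: "x \<in> carrier S" "y \<in> carrier S" "x \<sqsubseteq> y"
  shows "lattice (restricted (carrier (B x) \<inter> carrier (B y)))" (is "lattice (restricted ?A)")
proof -
  interpret P: partial_order glued by (rule glued_partial_order)
  interpret A: weak_partial_order "restricted ?A"
    by (rule weak_partial_order_subset[OF P.weak_partial_order_axioms]) (use xy in auto)
  show ?thesis
  proof unfold_locales
    fix a b assume "a \<in> carrier (restricted ?A)" "b \<in> carrier (restricted ?A)"
    then have a: "a \<in> carrier (B x)" "a \<in> carrier (B y)"
      and b: "b \<in> carrier (B x)" "b \<in> carrier (B y)" by auto
    note jy = block_join[OF xy(2) a(2) b(2)] and mx = block_meet[OF xy(1) a(1) b(1)]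
    have j: "a \<squnion>\<^bsub>B y\<^esub> b \<in> ?A" using jy(1) join_mem_lower(1)[OF xy a b] by blast
    have "is_lub (restricted ?A) (a \<squnion>\<^bsub>B y\<^esub> b) {a, b}"
      using j a b jy glued_le_iff[OF xy(2)] by (intro least_UpperI) (auto simp: Upper_def)
    then show "\<exists>s. is_lub (restricted ?A) s {a, b}" by blast
    have m: "a \<sqinter>\<^bsub>B x\<^esub> b \<in> ?A" using mx(1) meet_mem_upper[OF xy a b] by blast
    have "is_glb (restricted ?A) (a \<sqinter>\<^bsub>B x\<^esub> b) {a, b}"
      using m a b mx glued_le_iff[OF xy(1)] by (intro greatest_LowerI) (auto simp: Lower_def)
    then show "\<exists>s. is_glb (restricted ?A) s {a, b}" by blast
  qed simp
qed

lemma lattice_filter_inter: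
  assumes xy: "x \<in> carrier S" "y \<in> carrier S" "x \<sqsubseteq> y"
  shows "lattice_filter (restricted (carrier (B x))) (carrier (B x) \<inter> carrier (B y))"
  unfolding lattice_filter_def
proof (intro conjI ballI impI)
  fix a b assume a: "a \<in> carrier (B x) \<inter> carrier (B y)"
  { assume b: "b \<in> carrier (B x) \<inter> carrier (B y)"
    show "a \<sqinter>\<^bsub>restricted (carrier (B x))\<^esub> b \<in> carrier (B x) \<inter> carrier (B y)"
      using meet_mem_upper[OF xy, of a b] block_meet(1)[OF xy(1), of a b]
        restricted_meet[OF xy(1), of a b] a b by simp }
  { assume b: "b \<in> carrier (restricted (carrier (B x)))" "a \<sqsubseteq>\<^bsub>restricted (carrier (B x))\<^esub> b"
    then show "b \<in> carrier (B x) \<inter> carrier (B y)"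
      using le_up[OF xy, of a b] glued_le_iff[OF xy(1), of a b] a by simp }
qed simp

lemma lattice_ideal_inter:
  assumes xy: "x \<in> carrier S" "y \<in> carrier S" "x \<sqsubseteq> y"
  shows "lattice_ideal (restricted (carrier (B y))) (carrier (B x) \<inter> carrier (B y))"
  unfolding lattice_ideal_def
proof (intro conjI ballI impI)
  fix a b assume a: "a \<in> carrier (B x) \<inter> carrier (B y)"
  { assume b: "b \<in> carrier (B x) \<inter> carrier (B y)"
    show "a \<squnion>\<^bsub>restricted (carrier (B y))\<^esub> b \<in> carrier (B x) \<inter> carrier (B y)"
      using join_mem_lower(1)[OF xy, of a b] block_join(1)[OF xy(2), of a b]
        restricted_join[OF xy(2), of a b] a b by simp }
  { assume b: "b \<in> carrier (restricted (carrier (B y)))" "b \<sqsubseteq>\<^bsub>restricted (carrier (B y))\<^esub> a"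
    then show "b \<in> carrier (B x) \<inter> carrier (B y)"
      using le_down[OF xy, of a b] glued_le_iff[OF xy(2), of b a] a by simp }
qed simp

lemma lattice_iso_inter:
  assumes xy: "x \<in> carrier S" "y \<in> carrier S" "x \<sqsubseteq> y"
  shows "lattice_iso (restricted (carrier (B x) \<inter> carrier (B y)))
    (restricted (carrier (B x) \<inter> carrier (B y))) (\<lambda>a. a)"
  using lattice_inter[OF xy]
  by (simp add: lattice_iso_def join_pres_def meet_pres_def bij_betw_def)

text \<open>Skeleton and blocks are transported along \<open>skeleton_iso\<close> and
  \<open>block_iso\<close>. With identities as connecting maps, MC5 only asks that a point common to
  three blocks be common to two of them, MC6 reduces to \<open>mem_between\<close>, and MC7 to
  \<open>mem_join\<close> and \<open>mem_meet\<close>.\<close>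

theorem dissection_mc_system: "mc_system (dissection glued)"
proof -
  interpret K: order_isomorphism S "block_skeleton glued" "\<lambda>x. carrier (B x)"
    by (rule skeleton_iso)
  note latS = S.lattice_axioms
  have blocks: "carrier (block_skeleton glued) = (\<lambda>x. carrier (B x)) ` carrier S"
    by (rule K.image_carrier[symmetric])
  have join: "carrier (B x) \<squnion>\<^bsub>block_skeleton glued\<^esub> carrier (B y) = carrier (B (x \<squnion> y))"
    and meet: "carrier (B x) \<sqinter>\<^bsub>block_skeleton glued\<^esub> carrier (B y) = carrier (B (x \<sqinter> y))"
    if "x \<in> carrier S" "y \<in> carrier S" for x y
    using K.join_image[OF latS that] K.meet_image[OF latS that] by simp_all
  have nonempty: "carrier (B x) \<noteq> {}" if "x \<in> carrier S" for x
    using block_bounds(1)[OF that] by blast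
  have tolE: thesis if "tol_le (dissection glued) X Y"
    and "\<And>x y. \<lbrakk>x \<in> carrier S; y \<in> carrier S; x \<sqsubseteq> y; X = carrier (B x); Y = carrier (B y);
      carrier (B x) \<inter> carrier (B y) \<noteq> {}\<rbrakk> \<Longrightarrow> thesis" for X Y thesis
    using that K.le_iff unfolding tol_le_def dissection_simps is_block_glued_iff by blast
  show ?thesis
  proof (rule mc_system.intro, unfold dissection_simps)
    show "lattice (block_skeleton glued)" by (rule K.lattice_target[OF latS])
    show "tolerance (block_skeleton glued)
      {(X, Y). is_block glued X \<and> is_block glued Y \<and> X \<inter> Y \<noteq> {}}" (is "tolerance _ ?R")
      unfolding tolerance_def
    proof (intro conjI allI impI)
      show "?R \<subseteq> carrier (block_skeleton glued) \<times> carrier (block_skeleton glued)"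
        by (auto simp: block_skeleton_def)
      show "refl_on (carrier (block_skeleton glued)) ?R"
        using nonempty by (auto simp: refl_on_def blocks is_block_glued_iff)
      show "sym ?R" by (auto simp: sym_def)
      fix X Y Z W assume "(X, Y) \<in> ?R" "(Z, W) \<in> ?R"
      then obtain x y z w where
        c: "x \<in> carrier S" "y \<in> carrier S" "z \<in> carrier S" "w \<in> carrier S"
        and eq: "X = carrier (B x)" "Y = carrier (B y)" "Z = carrier (B z)" "W = carrier (B w)"
        and m: "carrier (B x) \<inter> carrier (B y) \<noteq> {}" "carrier (B z) \<inter> carrier (B w) \<noteq> {}"
        unfolding is_block_glued_iff by blast
      let ?T = "{(x, y). x \<in> carrier S \<and> y \<in> carrier S \<and> carrier (B x) \<inter> carrier (B y) \<noteq> {}}"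
      have "(x, y) \<in> ?T" "(z, w) \<in> ?T" using c m by auto
      then have "(x \<squnion> z, y \<squnion> w) \<in> ?T" "(x \<sqinter> z, y \<sqinter> w) \<in> ?T"
        using meets_tolerance unfolding tolerance_def by blast+
      then show "(X \<squnion>\<^bsub>block_skeleton glued\<^esub> Z, Y \<squnion>\<^bsub>block_skeleton glued\<^esub> W) \<in> ?R"
        "(X \<sqinter>\<^bsub>block_skeleton glued\<^esub> Z, Y \<sqinter>\<^bsub>block_skeleton glued\<^esub> W) \<in> ?R"
        unfolding eq join[OF c(1,3)] join[OF c(2,4)] meet[OF c(1,3)] meet[OF c(2,4)]
          is_block_glued_iff by blast+
    qed
    show "lffc (block_skeleton glued)" by (rule K.lffc_target[OF S_lffc])
    show "finite (carrier (restricted X)) \<and> modular_lattice (restricted X)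
      \<and> complemented_lattice (restricted X)" if X: "X \<in> carrier (block_skeleton glued)" for X
    proof -
      obtain x where x: "x \<in> carrier S" "X = carrier (B x)" using X unfolding blocks by blast
      interpret I: order_isomorphism "B x" "restricted (carrier (B x))" id
        by (rule block_iso[OF x(1)])
      show ?thesis unfolding x(2)
        using block_finite[OF x(1)] I.modular_target[OF block_modular[OF x(1)]]
          I.complemented_target[OF block_complemented[OF x(1)]] by simp
    qed
    show "X \<inter> Y \<noteq> {} \<and> lattice_filter (restricted X) (X \<inter> Y) \<and> lattice_ideal (restricted Y) (X \<inter> Y)
      \<and> lattice_iso ((restricted X)\<lparr>carrier := X \<inter> Y\<rparr>) ((restricted Y)\<lparr>carrier := X \<inter> Y\<rparr>) (\<lambda>a. a)"
      if XY: "tol_le (dissection glued) X Y" for X Y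
    proof (rule tolE[OF XY])
      fix x y
      assume xy: "x \<in> carrier S" "y \<in> carrier S" "x \<sqsubseteq> y"
        and eq: "X = carrier (B x)" "Y = carrier (B y)"
        and m: "carrier (B x) \<inter> carrier (B y) \<noteq> {}"
      show ?thesis
        unfolding eq
        using m lattice_filter_inter[OF xy] lattice_ideal_inter[OF xy] lattice_iso_inter[OF xy]
        by simp
    qed
    show "X \<inter> X = carrier (restricted X) \<and> X \<inter> X = carrier (restricted X)
      \<and> (\<forall>a \<in> carrier (restricted X). a = a)" for X by simp
    show "(X, Z) \<in> {(B, B'). is_block glued B \<and> is_block glued B' \<and> B \<inter> B' \<noteq> {}}"
      if "tol_le (dissection glued) X Y" "tol_le (dissection glued) Y Z" "X \<inter> Y \<inter> (Y \<inter> Z) \<noteq> {}"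
      for X Y Z
      using that unfolding tol_le_def dissection_simps by blast
    show "X \<inter> Y = {a \<in> X \<inter> Z. a \<in> X \<inter> Z \<inter> (Z \<inter> Y)}
      \<and> X \<inter> Y = (\<lambda>a. a) ` (X \<inter> Z \<inter> (Z \<inter> Y)) \<and> (\<forall>a \<in> X \<inter> Y. a = a)"
      if X: "X \<in> carrier (block_skeleton glued)" and Z: "Z \<in> carrier (block_skeleton glued)"
        and Y: "Y \<in> carrier (block_skeleton glued)"
        and le: "X \<sqsubseteq>\<^bsub>block_skeleton glued\<^esub> Z" "Z \<sqsubseteq>\<^bsub>block_skeleton glued\<^esub> Y" for X Z Y
    proof -
      obtain x z y where c: "x \<in> carrier S" "z \<in> carrier S" "y \<in> carrier S"
        and eq: "X = carrier (B x)" "Z = carrier (B z)" "Y = carrier (B y)"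
        using X Y Z unfolding blocks by blast
      have "x \<sqsubseteq> z" "z \<sqsubseteq> y" using le c K.le_iff by (simp_all add: eq)
      then have "X \<inter> Y \<subseteq> Z" using mem_between[OF c] by (auto simp: eq)
      then show ?thesis by auto
    qed
    show "X \<inter> (X \<squnion>\<^bsub>block_skeleton glued\<^esub> Y) \<inter> (Y \<inter> (X \<squnion>\<^bsub>block_skeleton glued\<^esub> Y))
        \<subseteq> X \<sqinter>\<^bsub>block_skeleton glued\<^esub> Y \<inter> (X \<squnion>\<^bsub>block_skeleton glued\<^esub> Y)
      \<and> X \<sqinter>\<^bsub>block_skeleton glued\<^esub> Y \<inter> X \<inter> (X \<sqinter>\<^bsub>block_skeleton glued\<^esub> Y \<inter> Y)
        \<subseteq> X \<sqinter>\<^bsub>block_skeleton glued\<^esub> Y \<inter> (X \<squnion>\<^bsub>block_skeleton glued\<^esub> Y)"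
      if XY: "(X, Y) \<in> {(B, B'). is_block glued B \<and> is_block glued B' \<and> B \<inter> B' \<noteq> {}}" for X Y
    proof -
      obtain x y where c: "x \<in> carrier S" "y \<in> carrier S"
        and eq: "X = carrier (B x)" "Y = carrier (B y)"
        using XY unfolding is_block_glued_iff by blast
      show ?thesis
        unfolding eq join[OF c] meet[OF c] using mem_join[OF c] mem_meet[OF c] by blast
    qed
    have coverE: "\<exists>x y. covers S x y \<and> X = carrier (B x) \<and> Y = carrier (B y)"
      if "covers (block_skeleton glued) X Y" for X Y
    proof -
      have "X \<in> carrier (block_skeleton glued)" "Y \<in> carrier (block_skeleton glued)"
        using that by (simp_all add: covers_def)
      then obtain x y where c: "x \<in> carrier S" "y \<in> carrier S" "X = carrier (B x)" "Y = carrier (B y)"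
        unfolding blocks by blast
      then show ?thesis using that K.covers_image by blast
    qed
    show "(X, Y) \<in> {(B, B'). is_block glued B \<and> is_block glued B' \<and> B \<inter> B' \<noteq> {}}"
      if cov: "covers (block_skeleton glued) X Y" for X Y
    proof -
      obtain x y where "covers S x y" "X = carrier (B x)" "Y = carrier (B y)"
        using coverE[OF cov] by blast
      then show ?thesis using cover_meets covers_S is_block_glued_iff by blast
    qed
    show "X \<inter> Y \<noteq> carrier (restricted X) \<and> X \<inter> Y \<noteq> carrier (restricted Y)"
      if cov: "covers (block_skeleton glued) X Y" for X Y
    proof -
      obtain x y where "covers S x y" "X = carrier (B x)" "Y = carrier (B y)"
        using coverE[OF cov] by blast
      then show ?thesis using cover_not_subset[of x y] by auto
    qed
  qed
qed

end

section \<open>The sum of a modular connected system\<close>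

context mc_system
begin

interpretation S: lattice "Skel C" by (rule skeleton_lattice)

abbreviation skel_le (infix \<open>\<le>\<^sub>S\<close> 50) where "x \<le>\<^sub>S y \<equiv> x \<sqsubseteq>\<^bsub>Skel C\<^esub> y"
abbreviation skel_join (infixl \<open>\<squnion>\<^sub>S\<close> 65) where "x \<squnion>\<^sub>S y \<equiv> x \<squnion>\<^bsub>Skel C\<^esub> y"
abbreviation skel_meet (infixl \<open>\<sqinter>\<^sub>S\<close> 70) where "x \<sqinter>\<^sub>S y \<equiv> x \<sqinter>\<^bsub>Skel C\<^esub> y"

section \<open>The tolerance of the skeleton\<close>

lemma tol_carrier: "(x, y) \<in> Tol C \<Longrightarrow> x \<in> carrier (Skel C) \<and> y \<in> carrier (Skel C)"
  using tolerance unfolding tolerance_def by blast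

lemma tol_refl: "x \<in> carrier (Skel C) \<Longrightarrow> (x, x) \<in> Tol C"
  using tolerance unfolding tolerance_def refl_on_def by blast

lemma tol_sym: "(x, y) \<in> Tol C \<Longrightarrow> (y, x) \<in> Tol C"
  using tolerance unfolding tolerance_def sym_def by blast

lemma tol_join: "(a, b) \<in> Tol C \<Longrightarrow> (c, d) \<in> Tol C \<Longrightarrow> (a \<squnion>\<^sub>S c, b \<squnion>\<^sub>S d) \<in> Tol C"
  using tolerance unfolding tolerance_def by blast

lemma tol_meet: "(a, b) \<in> Tol C \<Longrightarrow> (c, d) \<in> Tol C \<Longrightarrow> (a \<sqinter>\<^sub>S c, b \<sqinter>\<^sub>S d) \<in> Tol C"
  using tolerance unfolding tolerance_def by blast

lemma join_absorb_le: "x \<in> carrier (Skel C) \<Longrightarrow> y \<in> carrier (Skel C) \<Longrightarrow> x \<le>\<^sub>S y \<Longrightarrow> x \<squnion>\<^sub>S y = y"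
  using S.le_iff_meet[of x y] by simp

lemma join_absorb_ge: "x \<in> carrier (Skel C) \<Longrightarrow> y \<in> carrier (Skel C) \<Longrightarrow> y \<le>\<^sub>S x \<Longrightarrow> x \<squnion>\<^sub>S y = x"
  using join_absorb_le join_comm by metis

lemma meet_absorb_le: "x \<in> carrier (Skel C) \<Longrightarrow> y \<in> carrier (Skel C) \<Longrightarrow> x \<le>\<^sub>S y \<Longrightarrow> x \<sqinter>\<^sub>S y = x"
  using S.le_iff_join[of x y] by simp

text \<open>Take the meet and the join of the pair \<open>(x, y)\<close> with the pair
  \<open>(z, z)\<close>.\<close>

lemma tol_interval:
  assumes "x \<in> carrier (Skel C)" "z \<in> carrier (Skel C)" "y \<in> carrier (Skel C)"
    and "x \<le>\<^sub>S z" "z \<le>\<^sub>S y" "(x, y) \<in> Tol C"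
  shows "(x, z) \<in> Tol C" "(z, y) \<in> Tol C"
proof -
  have "(x \<sqinter>\<^sub>S z, y \<sqinter>\<^sub>S z) \<in> Tol C" "(x \<squnion>\<^sub>S z, y \<squnion>\<^sub>S z) \<in> Tol C"
    using tol_join tol_meet tol_refl assms by blast+
  moreover have "x \<sqinter>\<^sub>S z = x" "x \<squnion>\<^sub>S z = z" "y \<squnion>\<^sub>S z = y" "y \<sqinter>\<^sub>S z = z"
    using meet_absorb_le join_absorb_le join_absorb_ge assms meet_comm by metis+
  ultimately show "(x, z) \<in> Tol C" "(z, y) \<in> Tol C" by simp_all
qed

lemma tol_join_right:
  assumes "(x, y) \<in> Tol C" shows "(x, x \<squnion>\<^sub>S y) \<in> Tol C"
proof -
  have x: "x \<in> carrier (Skel C)" using tol_carrier[OF assms] by blast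
  then show ?thesis using tol_join[OF tol_refl[OF x] assms] join_absorb_le[OF x x] by simp
qed

lemma tol_meet_left:
  assumes "(x, y) \<in> Tol C" shows "(x \<sqinter>\<^sub>S y, x) \<in> Tol C"
proof -
  have x: "x \<in> carrier (Skel C)" using tol_carrier[OF assms] by blast
  have "(x \<sqinter>\<^sub>S x, x \<sqinter>\<^sub>S y) \<in> Tol C" using tol_meet[OF tol_refl[OF x] assms] .
  then show ?thesis using tol_sym meet_absorb_le[OF x x] x by simp
qed

text \<open>The join of the pairs with first entry \<open>x \<sqinter>\<^sub>S y\<close> and second
  entries \<open>x\<close> and \<open>y\<close>. It gives meaning to the filters and ideals between
  \<open>x \<sqinter>\<^sub>S y\<close> and \<open>x \<squnion>\<^sub>S y\<close> that occur in
  MC7.\<close>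

lemma tol_meet_join:
  assumes "(x, y) \<in> Tol C" shows "(x \<sqinter>\<^sub>S y, x \<squnion>\<^sub>S y) \<in> Tol C"
proof -
  have c: "x \<in> carrier (Skel C)" "y \<in> carrier (Skel C)" using tol_carrier[OF assms] by blast+
  have le: "x \<sqinter>\<^sub>S y \<le>\<^sub>S x" "x \<sqinter>\<^sub>S y \<le>\<^sub>S y" using S.meet_left S.meet_right c by blast+
  have "(x \<sqinter>\<^sub>S y, y) \<in> Tol C" using tol_meet_left[OF tol_sym[OF assms]] meet_comm by metis
  then have "(x \<sqinter>\<^sub>S y \<squnion>\<^sub>S (x \<sqinter>\<^sub>S y), x \<squnion>\<^sub>S y) \<in> Tol C"
    using tol_join[OF tol_meet_left[OF assms]] by blast
  moreover have "x \<sqinter>\<^sub>S y \<squnion>\<^sub>S (x \<sqinter>\<^sub>S y) = x \<sqinter>\<^sub>S y" using c by (intro join_absorb_le) auto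
  ultimately show ?thesis by simp
qed

lemma tol_leI: "x \<le>\<^sub>S y \<Longrightarrow> (x, y) \<in> Tol C \<Longrightarrow> tol_le C x y"
  by (simp add: tol_le_def)

section \<open>The connecting maps\<close>

lemma Fil_subset: "tol_le C x y \<Longrightarrow> Fil C x y \<subseteq> carrier (Blk C x)"
  using MC3 unfolding lattice_filter_def by blast

lemma Idl_subset: "tol_le C x y \<Longrightarrow> Idl C x y \<subseteq> carrier (Blk C y)"
  using MC3 unfolding lattice_ideal_def by blast

lemma Fil_up: "\<lbrakk>tol_le C x y; a \<in> Fil C x y; b \<in> carrier (Blk C x); a \<sqsubseteq>\<^bsub>Blk C x\<^esub> b\<rbrakk> \<Longrightarrow> b \<in> Fil C x y"
  using MC3 unfolding lattice_filter_def by blast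

lemma Idl_down: "\<lbrakk>tol_le C x y; b \<in> Idl C x y; a \<in> carrier (Blk C y); a \<sqsubseteq>\<^bsub>Blk C y\<^esub> b\<rbrakk> \<Longrightarrow> a \<in> Idl C x y"
  using MC3 unfolding lattice_ideal_def by blast

lemma Phi_Idl: "a \<in> Fil C x y \<Longrightarrow> Phi C x y a \<in> Idl C x y"
  by (simp add: Idl_def)

lemma Phi_Blk: "tol_le C x y \<Longrightarrow> a \<in> Fil C x y \<Longrightarrow> Phi C x y a \<in> carrier (Blk C y)"
  using Idl_subset Phi_Idl by blast

lemma Phi_le_iff:
  assumes "tol_le C x y" "a \<in> Fil C x y" "b \<in> Fil C x y"
  shows "Phi C x y a \<sqsubseteq>\<^bsub>Blk C y\<^esub> Phi C x y b \<longleftrightarrow> a \<sqsubseteq>\<^bsub>Blk C x\<^esub> b"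
  using lattice_iso_le_iff[of "Blk C x\<lparr>carrier := Fil C x y\<rparr>" "Blk C y\<lparr>carrier := Idl C x y\<rparr>"
      "Phi C x y" a b] MC3[OF assms(1)] assms(2,3) by simp

lemma Phi_inj:
  assumes "tol_le C x y" "a \<in> Fil C x y" "b \<in> Fil C x y"
  shows "Phi C x y a = Phi C x y b \<longleftrightarrow> a = b"
proof -
  have "inj_on (Phi C x y) (Fil C x y)"
    using MC3[OF assms(1)] by (simp add: lattice_iso_def bij_betw_def)
  then show ?thesis using assms(2,3) by (simp add: inj_on_eq_iff)
qed

lemma Fil_interval:
  assumes "x \<in> carrier (Skel C)" "z \<in> carrier (Skel C)" "y \<in> carrier (Skel C)"
    and "x \<le>\<^sub>S z" "z \<le>\<^sub>S y" "(x, y) \<in> Tol C"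
  shows "a \<in> Fil C x y \<longleftrightarrow> a \<in> Fil C x z \<and> Phi C x z a \<in> Fil C z y"
    and "a \<in> Fil C x y \<Longrightarrow> Phi C x y a = Phi C z y (Phi C x z a)"
proof -
  have eq: "Fil C x y = {a \<in> Fil C x z. Phi C x z a \<in> Idl C x z \<inter> Fil C z y}"
    and "\<forall>a \<in> Fil C x y. Phi C x y a = Phi C z y (Phi C x z a)"
    using MC6[OF assms] by blast+
  then show "a \<in> Fil C x y \<Longrightarrow> Phi C x y a = Phi C z y (Phi C x z a)" by blast
  show "a \<in> Fil C x y \<longleftrightarrow> a \<in> Fil C x z \<and> Phi C x z a \<in> Fil C z y"
    unfolding eq using Phi_Idl by blast
qed

text \<open>MC6 factors a map whose ends are already tolerant. MC5 supplies that tolerance from a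
  single element on which both maps are defined in succession.\<close>

lemma Fil_compose:
  assumes xz: "tol_le C x z" and zy: "tol_le C z y"
    and a: "a \<in> Fil C x z" "Phi C x z a \<in> Fil C z y"
  shows "(x, y) \<in> Tol C" "x \<le>\<^sub>S y" "a \<in> Fil C x y" "Phi C x y a = Phi C z y (Phi C x z a)"
proof -
  show t: "(x, y) \<in> Tol C" using MC5[OF xz zy] Phi_Idl[OF a(1)] a(2) by blast
  have le: "x \<le>\<^sub>S z" "z \<le>\<^sub>S y" using xz zy by (simp_all add: tol_le_def)
  have c: "x \<in> carrier (Skel C)" "z \<in> carrier (Skel C)" "y \<in> carrier (Skel C)"
    using xz zy tol_carrier unfolding tol_le_def by blast+
  show "x \<le>\<^sub>S y" using S.le_trans[OF le c] .
  show "a \<in> Fil C x y" using Fil_interval(1)[OF c le t] a by blast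
  then show "Phi C x y a = Phi C z y (Phi C x z a)" using Fil_interval(2)[OF c le t] by blast
qed

section \<open>The gluing relation\<close>

abbreviation glue :: "'s \<Rightarrow> 'a \<Rightarrow> 's \<Rightarrow> 'a \<Rightarrow> bool" where
  "glue x a y b \<equiv> ((x, a), (y, b)) \<in> sum_rel C"

lemma glue_iff:
  "glue x a y b \<longleftrightarrow> x \<in> carrier (Skel C) \<and> a \<in> carrier (Blk C x) \<and> y \<in> carrier (Skel C)
    \<and> b \<in> carrier (Blk C y) \<and> (x, y) \<in> Tol C \<and> a \<in> Fil C x (x \<squnion>\<^sub>S y) \<and> b \<in> Fil C y (x \<squnion>\<^sub>S y)
    \<and> Phi C x (x \<squnion>\<^sub>S y) a = Phi C y (x \<squnion>\<^sub>S y) b"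
  by (auto simp: sum_rel_def sum_points_def)

text \<open>The relation is defined by agreement at \<open>x \<squnion>\<^sub>S y\<close>. Agreement
  at any common upper index \<open>t\<close> suffices, because both maps to \<open>t\<close> factor
  through the join and the map from the join to \<open>t\<close> is injective.\<close>

lemma glueI_upper:
  assumes xt: "tol_le C x t" and yt: "tol_le C y t"
    and ab: "a \<in> Fil C x t" "b \<in> Fil C y t" "Phi C x t a = Phi C y t b"
  shows "glue x a y b"
proof -
  have c: "x \<in> carrier (Skel C)" "y \<in> carrier (Skel C)" "t \<in> carrier (Skel C)"
    and le: "x \<le>\<^sub>S t" "y \<le>\<^sub>S t" and tol: "(x, t) \<in> Tol C" "(y, t) \<in> Tol C"
    using xt yt tol_carrier unfolding tol_le_def by blast+
  have xy: "(x, y) \<in> Tol C"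
    using tol_meet[OF tol(1) tol_sym[OF tol(2)]] meet_absorb_le c le meet_comm by metis
  let ?s = "x \<squnion>\<^sub>S y"
  have s: "?s \<in> carrier (Skel C)" "x \<le>\<^sub>S ?s" "y \<le>\<^sub>S ?s" "?s \<le>\<^sub>S t"
    using c le S.join_left S.join_right S.join_le by simp_all
  note fx = Fil_interval[OF c(1) s(1) c(3) s(2,4) tol(1)]
    and fy = Fil_interval[OF c(2) s(1) c(3) s(3,4) tol(2)]
  have st: "tol_le C ?s t" using tol_interval(2)[OF c(1) s(1) c(3) s(2,4) tol(1)] s(4) tol_leI by blast
  have m: "a \<in> Fil C x ?s" "Phi C x ?s a \<in> Fil C ?s t" "b \<in> Fil C y ?s" "Phi C y ?s b \<in> Fil C ?s t"
    using fx(1) fy(1) ab by blast+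
  have "Phi C ?s t (Phi C x ?s a) = Phi C ?s t (Phi C y ?s b)"
    using fx(2)[OF ab(1)] fy(2)[OF ab(2)] ab(3) by simp
  then have "Phi C x ?s a = Phi C y ?s b" using Phi_inj[OF st m(2,4)] by blast
  then show ?thesis
    unfolding glue_iff using c xy m Fil_subset[OF xt] Fil_subset[OF yt] ab by blast
qed

lemma glueE_upper:
  assumes "glue x a y b"
  shows "tol_le C x (x \<squnion>\<^sub>S y)" "tol_le C y (x \<squnion>\<^sub>S y)" "a \<in> Fil C x (x \<squnion>\<^sub>S y)"
    "b \<in> Fil C y (x \<squnion>\<^sub>S y)" "Phi C x (x \<squnion>\<^sub>S y) a = Phi C y (x \<squnion>\<^sub>S y) b"
proof -
  have c: "x \<in> carrier (Skel C)" "y \<in> carrier (Skel C)" and t: "(x, y) \<in> Tol C"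
    using assms by (simp_all add: glue_iff)
  show "tol_le C x (x \<squnion>\<^sub>S y)" using tol_leI S.join_left c tol_join_right[OF t] by blast
  show "tol_le C y (x \<squnion>\<^sub>S y)"
    using tol_leI S.join_right c tol_join_right[OF tol_sym[OF t]] join_comm by metis
qed (use assms in \<open>simp_all add: glue_iff\<close>)

lemma glue_le_iff:
  assumes "x \<in> carrier (Skel C)" "y \<in> carrier (Skel C)" "x \<le>\<^sub>S y"
  shows "glue x a y b \<longleftrightarrow> (x, y) \<in> Tol C \<and> a \<in> Fil C x y \<and> b = Phi C x y a"
proof -
  have "x \<squnion>\<^sub>S y = y" using join_absorb_le assms by blast
  moreover have "a \<in> carrier (Blk C x)" "Phi C x y a \<in> carrier (Blk C y)"
    if "(x, y) \<in> Tol C" "a \<in> Fil C x y"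
    using that assms(3) tol_leI Fil_subset Phi_Blk by blast+
  ultimately show ?thesis using assms MC4[OF assms(2)] unfolding glue_iff by auto
qed

lemma glue_sym: "glue x a y b \<Longrightarrow> glue y b x a"
  unfolding glue_iff using tol_sym join_comm by metis

lemma glue_refl: "x \<in> carrier (Skel C) \<Longrightarrow> a \<in> carrier (Blk C x) \<Longrightarrow> glue x a x a"
  using glue_le_iff[of x x a a] tol_refl MC4 by simp

text \<open>The filter half of MC7 pushes the element given by \<open>b\<close> up to the join of all three indices;
  MC5 then provides the tolerances needed there.\<close>

lemma glue_trans:
  assumes ab: "glue x a y b" and bc: "glue y b z c"
  shows "glue x a z c"
proof -
  let ?u = "x \<squnion>\<^sub>S y" and ?v = "y \<squnion>\<^sub>S z"
  let ?w = "?u \<sqinter>\<^sub>S ?v" and ?t = "?u \<squnion>\<^sub>S ?v"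
  note u = glueE_upper[OF ab] and v = glueE_upper[OF bc]
  have c: "x \<in> carrier (Skel C)" "y \<in> carrier (Skel C)" "z \<in> carrier (Skel C)"
    using ab bc by (simp_all add: glue_iff)
  then have cu: "?u \<in> carrier (Skel C)" and cv: "?v \<in> carrier (Skel C)"
    and cw: "?w \<in> carrier (Skel C)" and ct: "?t \<in> carrier (Skel C)" by simp_all
  have yu: "(y, ?u) \<in> Tol C" "y \<le>\<^sub>S ?u" and yv: "(y, ?v) \<in> Tol C" "y \<le>\<^sub>S ?v"
    using u v by (simp_all add: tol_le_def)
  \<comment> \<open>Join the tolerant pairs \<open>(?u, y)\<close> and \<open>(y, ?v)\<close>; both
    \<open>?u\<close> and \<open>?v\<close> absorb \<open>y\<close>.\<close>
  have uv: "(?u, ?v) \<in> Tol C"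
    using tol_join[OF tol_sym[OF yu(1)] yv(1)] join_absorb_le[OF c(2) cv yv(2)]
      join_absorb_ge[OF cu c(2) yu(2)] by simp
  have w: "y \<le>\<^sub>S ?w" "?w \<le>\<^sub>S ?u" "?w \<le>\<^sub>S ?v"
    using S.meet_le[OF yu(2) yv(2) cu cv c(2)] S.meet_left[OF cu cv] S.meet_right[OF cu cv] .
  have t: "?u \<le>\<^sub>S ?t" "?v \<le>\<^sub>S ?t" using S.join_left[OF cu cv] S.join_right[OF cu cv] .
  have wt: "(?w, ?t) \<in> Tol C" by (rule tol_meet_join[OF uv])
  \<comment> \<open>The index \<open>?w\<close> lies between \<open>y\<close> and each of
    \<open>?u\<close> and \<open>?v\<close>, so \<open>b\<close> can be carried to
    \<open>?w\<close>. Its image there lies in both filters that MC7 intersects for the pair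
    \<open>?u\<close>, \<open>?v\<close>.\<close>
  let ?b = "Phi C y ?w b"
  note fu = Fil_interval[OF c(2) cw cu w(1,2) yu(1)] and fv = Fil_interval[OF c(2) cw cv w(1,3) yv(1)]
  have "?b \<in> Fil C ?w ?u" "?b \<in> Fil C ?w ?v" using fu(1) fv(1) u(4) v(3) by blast+
  then have b: "?b \<in> Fil C ?w ?t" using MC7[OF uv] by blast
  note wu = Fil_interval[OF cw cu ct w(2) t(1) wt] and wv = Fil_interval[OF cw cv ct w(3) t(2) wt]
  have ut: "tol_le C ?u ?t" and vt: "tol_le C ?v ?t"
    using tol_interval(2)[OF cw cu ct w(2) t(1) wt] tol_interval(2)[OF cw cv ct w(3) t(2) wt] t tol_leI
    by blast+
  have ea: "Phi C x ?u a = Phi C ?w ?u ?b" using u(5) fu(2)[OF u(4)] by simp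
  have ec: "Phi C z ?v c = Phi C ?w ?v ?b" using v(5) fv(2)[OF v(3)] by simp
  have "Phi C x ?u a \<in> Fil C ?u ?t" "Phi C z ?v c \<in> Fil C ?v ?t"
    unfolding ea ec using wu(1) wv(1) b by blast+
  then have xt: "(x, ?t) \<in> Tol C" "x \<le>\<^sub>S ?t" "a \<in> Fil C x ?t"
      "Phi C x ?t a = Phi C ?u ?t (Phi C x ?u a)"
    and zt: "(z, ?t) \<in> Tol C" "z \<le>\<^sub>S ?t" "c \<in> Fil C z ?t"
      "Phi C z ?t c = Phi C ?v ?t (Phi C z ?v c)"
    using Fil_compose[OF u(1) ut u(3)] Fil_compose[OF v(2) vt v(4)] by blast+
  have "Phi C x ?t a = Phi C z ?t c"
    unfolding xt(4) zt(4) ea ec using wu(2)[OF b] wv(2)[OF b] by simp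
  then show ?thesis using glueI_upper tol_leI xt zt by blast
qed

lemma equiv_sum_rel: "equiv (sum_points C) (sum_rel C)"
proof (rule equivI)
  show "sum_rel C \<subseteq> sum_points C \<times> sum_points C" by (auto simp: sum_rel_def)
  show "refl_on (sum_points C) (sum_rel C)"
    using glue_refl by (auto simp: refl_on_def sum_points_def)
  show "sym (sum_rel C)" using glue_sym by (auto simp: sym_def)
  show "trans (sum_rel C)" using glue_trans by (fastforce simp: trans_def)
qed

section \<open>Images of the blocks in the sum\<close>

lemma sum_proj_eq_iff:
  assumes "x \<in> carrier (Skel C)" "a \<in> carrier (Blk C x)" "y \<in> carrier (Skel C)" "b \<in> carrier (Blk C y)"
  shows "sum_proj C x a = sum_proj C y b \<longleftrightarrow> glue x a y b"
  unfolding sum_proj_def using equiv_sum_rel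
  by (rule eq_equiv_class_iff) (use assms in \<open>simp_all add: sum_points_def\<close>)

lemma sum_quotient: "sum_points C // sum_rel C = (\<Union>x \<in> carrier (Skel C). sum_block C x)"
  by (auto simp: quotient_def sum_points_def sum_block_def sum_proj_def)

text \<open>Together with its counterpart for ideals this is the dictionary between the conditions
  on the system and the overlaps of images.\<close>

lemma sum_proj_mem_upper:
  assumes xy: "x \<in> carrier (Skel C)" "y \<in> carrier (Skel C)" "x \<le>\<^sub>S y" and a: "a \<in> carrier (Blk C x)"
  shows "sum_proj C x a \<in> sum_block C y \<longleftrightarrow> (x, y) \<in> Tol C \<and> a \<in> Fil C x y"
proof -
  have "Phi C x y a \<in> carrier (Blk C y)" if "(x, y) \<in> Tol C" "a \<in> Fil C x y"
    using that xy(3) tol_leI Phi_Blk by blast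
  then show ?thesis
    using sum_proj_eq_iff[OF xy(1) a xy(2)] glue_le_iff[OF xy] unfolding sum_block_def by blast
qed

lemma sum_proj_Phi:
  assumes "tol_le C x y" "a \<in> Fil C x y"
  shows "sum_proj C y (Phi C x y a) = sum_proj C x a"
proof -
  have c: "x \<in> carrier (Skel C)" "y \<in> carrier (Skel C)" "x \<le>\<^sub>S y" "(x, y) \<in> Tol C"
    using assms(1) tol_carrier unfolding tol_le_def by blast+
  have "glue x a y (Phi C x y a)" using glue_le_iff[OF c(1-3)] c(4) assms(2) by blast
  then have "sum_proj C x a = sum_proj C y (Phi C x y a)"
    using sum_proj_eq_iff[OF c(1) _ c(2)] by (simp add: glue_iff)
  then show ?thesis by simp
qed

lemma sum_proj_mem_lower:
  assumes xy: "x \<in> carrier (Skel C)" "y \<in> carrier (Skel C)" "x \<le>\<^sub>S y" and b: "b \<in> carrier (Blk C y)"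
  shows "sum_proj C y b \<in> sum_block C x \<longleftrightarrow> (x, y) \<in> Tol C \<and> b \<in> Idl C x y"
proof -
  have "sum_proj C y b \<in> sum_block C x \<longleftrightarrow> (\<exists>a \<in> carrier (Blk C x). glue x a y b)"
    using sum_proj_eq_iff[OF xy(1) _ xy(2) b] unfolding sum_block_def by blast
  also have "\<dots> \<longleftrightarrow> (x, y) \<in> Tol C \<and> b \<in> Idl C x y"
    unfolding glue_le_iff[OF xy] Idl_def using Fil_subset[of x y] xy(3) tol_leI by blast
  finally show ?thesis .
qed

lemma sum_block_inter:
  assumes "tol_le C x y"
  shows "sum_block C x \<inter> sum_block C y = sum_proj C x ` Fil C x y"
    and "sum_block C x \<inter> sum_block C y = sum_proj C y ` Idl C x y"
proof -
  have c: "x \<in> carrier (Skel C)" "y \<in> carrier (Skel C)" "x \<le>\<^sub>S y" "(x, y) \<in> Tol C"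
    using assms tol_carrier unfolding tol_le_def by blast+
  show "sum_block C x \<inter> sum_block C y = sum_proj C x ` Fil C x y"
    using sum_proj_mem_upper[OF c(1-3)] c(4) Fil_subset[OF assms] unfolding sum_block_def by blast
  show "sum_block C x \<inter> sum_block C y = sum_proj C y ` Idl C x y"
    using sum_proj_mem_lower[OF c(1-3)] c(4) Idl_subset[OF assms] unfolding sum_block_def by blast
qed

text \<open>For tolerant indices a common point is provided by any element of the nonempty filter
  from \<open>x \<sqinter>\<^sub>S y\<close> to \<open>x \<squnion>\<^sub>S y\<close>: by MC6 it
  also lies in the filters belonging to \<open>x\<close> and to \<open>y\<close>.\<close>

lemma sum_block_meets_iff:
  assumes "x \<in> carrier (Skel C)" "y \<in> carrier (Skel C)"
  shows "sum_block C x \<inter> sum_block C y \<noteq> {} \<longleftrightarrow> (x, y) \<in> Tol C"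
proof
  assume "sum_block C x \<inter> sum_block C y \<noteq> {}"
  then obtain a b where ab: "a \<in> carrier (Blk C x)" "b \<in> carrier (Blk C y)"
    "sum_proj C x a = sum_proj C y b" unfolding sum_block_def by blast
  then have "glue x a y b" using sum_proj_eq_iff assms by blast
  then show "(x, y) \<in> Tol C" by (simp add: glue_iff)
next
  assume t: "(x, y) \<in> Tol C"
  let ?m = "x \<sqinter>\<^sub>S y" and ?j = "x \<squnion>\<^sub>S y"
  have c: "?m \<in> carrier (Skel C)" "?j \<in> carrier (Skel C)" using assms by simp_all
  have mj: "(?m, ?j) \<in> Tol C" by (rule tol_meet_join[OF t])
  have le: "?m \<le>\<^sub>S x" "x \<le>\<^sub>S ?j" "?m \<le>\<^sub>S y" "y \<le>\<^sub>S ?j"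
    using S.meet_left S.meet_right S.join_left S.join_right assms by blast+
  have mjl: "tol_le C ?m ?j" using mj S.le_trans[OF le(1,2) c(1) assms(1) c(2)] tol_leI by blast
  then obtain a where a: "a \<in> Fil C ?m ?j" using MC3 by blast
  then have am: "a \<in> carrier (Blk C ?m)" using Fil_subset[OF mjl] by blast
  have "a \<in> Fil C ?m x" "a \<in> Fil C ?m y"
    using Fil_interval(1)[OF c(1) assms(1) c(2) le(1,2) mj] a
      Fil_interval(1)[OF c(1) assms(2) c(2) le(3,4) mj] by blast+
  moreover have "(?m, x) \<in> Tol C" "(?m, y) \<in> Tol C"
    using tol_interval(1)[OF c(1) assms(1) c(2) le(1,2) mj]
      tol_interval(1)[OF c(1) assms(2) c(2) le(3,4) mj] .
  ultimately have "sum_proj C ?m a \<in> sum_block C x" "sum_proj C ?m a \<in> sum_block C y"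
    using sum_proj_mem_upper[OF c(1) assms(1) le(1) am] sum_proj_mem_upper[OF c(1) assms(2) le(3) am]
    by blast+
  then show "sum_block C x \<inter> sum_block C y \<noteq> {}" by blast
qed

section \<open>The images of the blocks form a gluing\<close>

definition block_order :: "'s \<Rightarrow> ('s \<times> 'a) set gorder" where
  "block_order x = \<lparr>carrier = sum_block C x, eq = (=), le = sum_le_at C x\<rparr>"

lemma block_order_simps [simp]:
  "carrier (block_order x) = sum_block C x" "eq (block_order x) = (=)"
  "le (block_order x) = sum_le_at C x"
  by (simp_all add: block_order_def)

lemma sum_proj_inj:
  assumes "x \<in> carrier (Skel C)" shows "inj_on (sum_proj C x) (carrier (Blk C x))"
proof (rule inj_onI)
  fix a b assume "a \<in> carrier (Blk C x)" "b \<in> carrier (Blk C x)" "sum_proj C x a = sum_proj C x b"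
  then show "a = b"
    using sum_proj_eq_iff[OF assms _ assms] glue_le_iff[OF assms assms] S.le_refl[OF assms] MC4[OF assms]
    by simp
qed

lemma sum_le_at_proj:
  assumes "x \<in> carrier (Skel C)" "a \<in> carrier (Blk C x)" "b \<in> carrier (Blk C x)"
  shows "sum_le_at C x (sum_proj C x a) (sum_proj C x b) \<longleftrightarrow> a \<sqsubseteq>\<^bsub>Blk C x\<^esub> b"
  using assms(2,3) the_inv_into_f_f[OF sum_proj_inj[OF assms(1)]]
  by (simp add: sum_le_at_def sum_block_def)

lemma block_order_iso:
  assumes "x \<in> carrier (Skel C)"
  shows "order_isomorphism (Blk C x) (block_order x) (sum_proj C x)"
proof -
  interpret L: lattice "Blk C x" using MC2[OF assms] by (simp add: modular_lattice_def)
  show ?thesis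
  proof
    show "bij_betw (sum_proj C x) (carrier (Blk C x)) (carrier (block_order x))"
      using sum_proj_inj[OF assms] by (simp add: bij_betw_def sum_block_def)
  qed (use sum_le_at_proj[OF assms] in simp_all)
qed

lemma sum_block_join:
  assumes "x \<in> carrier (Skel C)" "y \<in> carrier (Skel C)" "\<alpha> \<in> sum_block C x" "\<alpha> \<in> sum_block C y"
  shows "\<alpha> \<in> sum_block C (x \<squnion>\<^sub>S y)"
proof -
  obtain a where a: "a \<in> carrier (Blk C x)" "\<alpha> = sum_proj C x a"
    using assms(3) unfolding sum_block_def by blast
  obtain b where b: "b \<in> carrier (Blk C y)" "\<alpha> = sum_proj C y b"
    using assms(4) unfolding sum_block_def by blast
  have "glue x a y b" using sum_proj_eq_iff[OF assms(1) a(1) assms(2) b(1)] a b by simp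
  note g = glueE_upper[OF this]
  then show ?thesis
    using sum_proj_mem_upper[of x "x \<squnion>\<^sub>S y" a] assms a unfolding tol_le_def by simp
qed

text \<open>Seen at \<open>x \<squnion>\<^sub>S y\<close>, the point lies in the ideals coming from
  \<open>x\<close> and from \<open>y\<close>; the ideal half of MC7 puts it into the ideal coming
  from the meet. For joins the definition of the gluing relation is enough.\<close>

lemma sum_block_meet:
  assumes "x \<in> carrier (Skel C)" "y \<in> carrier (Skel C)" "\<alpha> \<in> sum_block C x" "\<alpha> \<in> sum_block C y"
  shows "\<alpha> \<in> sum_block C (x \<sqinter>\<^sub>S y)"
proof -
  let ?m = "x \<sqinter>\<^sub>S y" and ?j = "x \<squnion>\<^sub>S y"
  obtain a where a: "a \<in> carrier (Blk C x)" "\<alpha> = sum_proj C x a"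
    using assms(3) unfolding sum_block_def by blast
  obtain b where b: "b \<in> carrier (Blk C y)" "\<alpha> = sum_proj C y b"
    using assms(4) unfolding sum_block_def by blast
  have ab: "glue x a y b" using sum_proj_eq_iff[OF assms(1) a(1) assms(2) b(1)] a b by simp
  note g = glueE_upper[OF ab]
  have t: "(x, y) \<in> Tol C" using ab by (simp add: glue_iff)
  have c: "?m \<in> carrier (Skel C)" "?j \<in> carrier (Skel C)" using assms by simp_all
  have le: "?m \<le>\<^sub>S x" "x \<le>\<^sub>S ?j" using S.meet_left S.join_left assms by blast+
  have mj: "tol_le C ?m ?j"
    using tol_meet_join[OF t] S.le_trans[OF le c(1) assms(1) c(2)] tol_leI by blast
  have "Phi C x ?j a \<in> Idl C x ?j" "Phi C x ?j a \<in> Idl C y ?j"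
    using Phi_Idl[OF g(3)] Phi_Idl[OF g(4)] g(5) by simp_all
  then have "Phi C x ?j a \<in> Idl C ?m ?j" using MC7[OF t] by blast
  then have "sum_proj C ?j (Phi C x ?j a) \<in> sum_block C ?m"
    using sum_block_inter(2)[OF mj] by blast
  then show ?thesis using sum_proj_Phi[OF g(1,3)] a(2) by simp
qed

lemma sum_block_between:
  assumes c: "x \<in> carrier (Skel C)" "z \<in> carrier (Skel C)" "y \<in> carrier (Skel C)"
    and le: "x \<le>\<^sub>S z" "z \<le>\<^sub>S y" and \<alpha>: "\<alpha> \<in> sum_block C x" "\<alpha> \<in> sum_block C y"
  shows "\<alpha> \<in> sum_block C z"
proof -
  obtain a where a: "a \<in> carrier (Blk C x)" "\<alpha> = sum_proj C x a"
    using \<alpha>(1) unfolding sum_block_def by blast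
  have f: "(x, y) \<in> Tol C" "a \<in> Fil C x y"
    using sum_proj_mem_upper[OF c(1,3) S.le_trans[OF le c] a(1)] \<alpha>(2) a(2) by blast+
  have "(x, z) \<in> Tol C" "a \<in> Fil C x z"
    using tol_interval(1)[OF c le f(1)] Fil_interval(1)[OF c le f(1)] f(2) by blast+
  then show ?thesis using sum_proj_mem_upper[OF c(1,2) le(1) a(1)] a(2) by blast
qed

lemma sum_le_at_up:
  assumes c: "x \<in> carrier (Skel C)" "y \<in> carrier (Skel C)" "x \<le>\<^sub>S y"
    and m: "\<alpha> \<in> sum_block C x" "\<alpha> \<in> sum_block C y" "\<beta> \<in> sum_block C x" and le: "sum_le_at C x \<alpha> \<beta>"
  shows "\<beta> \<in> sum_block C y" "sum_le_at C y \<alpha> \<beta>"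
proof -
  obtain a b where a: "a \<in> carrier (Blk C x)" "\<alpha> = sum_proj C x a"
    and b: "b \<in> carrier (Blk C x)" "\<beta> = sum_proj C x b"
    using m(1,3) unfolding sum_block_def by blast
  have ab: "a \<sqsubseteq>\<^bsub>Blk C x\<^esub> b" using le sum_le_at_proj[OF c(1) a(1) b(1)] a b by simp
  have t: "(x, y) \<in> Tol C" and aF: "a \<in> Fil C x y"
    using sum_proj_mem_upper[OF c a(1)] m(2) a(2) by blast+
  have xy: "tol_le C x y" using c(3) t by (rule tol_leI)
  have bF: "b \<in> Fil C x y" using Fil_up[OF xy aF b(1) ab] .
  then show "\<beta> \<in> sum_block C y" using sum_proj_mem_upper[OF c b(1)] t b(2) by blast
  have "sum_le_at C y (sum_proj C y (Phi C x y a)) (sum_proj C y (Phi C x y b))"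
    using sum_le_at_proj[OF c(2)] Phi_Blk[OF xy] Phi_le_iff[OF xy aF bF] aF bF ab by simp
  then show "sum_le_at C y \<alpha> \<beta>" using sum_proj_Phi[OF xy] aF bF a b by simp
qed

lemma sum_le_at_down:
  assumes c: "x \<in> carrier (Skel C)" "y \<in> carrier (Skel C)" "x \<le>\<^sub>S y"
    and m: "\<beta> \<in> sum_block C x" "\<beta> \<in> sum_block C y" "\<alpha> \<in> sum_block C y" and le: "sum_le_at C y \<alpha> \<beta>"
  shows "\<alpha> \<in> sum_block C x" "sum_le_at C x \<alpha> \<beta>"
proof -
  obtain a b where a: "a \<in> carrier (Blk C y)" "\<alpha> = sum_proj C y a"
    and b: "b \<in> carrier (Blk C y)" "\<beta> = sum_proj C y b"
    using m(2,3) unfolding sum_block_def by blast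
  have ab: "a \<sqsubseteq>\<^bsub>Blk C y\<^esub> b" using le sum_le_at_proj[OF c(2) a(1) b(1)] a b by simp
  have t: "(x, y) \<in> Tol C" and bI: "b \<in> Idl C x y"
    using sum_proj_mem_lower[OF c b(1)] m(1) b(2) by blast+
  have xy: "tol_le C x y" using c(3) t by (rule tol_leI)
  have aI: "a \<in> Idl C x y" using Idl_down[OF xy bI a(1) ab] .
  then show "\<alpha> \<in> sum_block C x" using sum_proj_mem_lower[OF c a(1)] t a(2) by blast
  obtain d e where d: "d \<in> Fil C x y" "a = Phi C x y d" and e: "e \<in> Fil C x y" "b = Phi C x y e"
    using aI bI unfolding Idl_def by blast
  have "d \<sqsubseteq>\<^bsub>Blk C x\<^esub> e" using ab Phi_le_iff[OF xy d(1) e(1)] d(2) e(2) by simp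
  then have "sum_le_at C x (sum_proj C x d) (sum_proj C x e)"
    using sum_le_at_proj[OF c(1)] Fil_subset[OF xy] d(1) e(1) by blast
  then show "sum_le_at C x \<alpha> \<beta>" using sum_proj_Phi[OF xy] d e a b by simp
qed

lemma gluing: "gluing (Skel C) block_order"
proof (rule gluing.intro[OF skeleton_lattice], unfold_locales, unfold block_order_simps)
  show "lffc (Skel C)" by (rule MC1)
  show "modular_lattice (block_order x)" "complemented_lattice (block_order x)" "finite (sum_block C x)"
    if "x \<in> carrier (Skel C)" for x
    using MC2[OF that] order_isomorphism.modular_target[OF block_order_iso[OF that]]
      order_isomorphism.complemented_target[OF block_order_iso[OF that]]
    by (simp_all add: sum_block_def)
  show "tolerance (Skel C) {(x, y). x \<in> carrier (Skel C) \<and> y \<in> carrier (Skel C)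
    \<and> sum_block C x \<inter> sum_block C y \<noteq> {}}"
  proof -
    have "{(x, y). x \<in> carrier (Skel C) \<and> y \<in> carrier (Skel C)
      \<and> sum_block C x \<inter> sum_block C y \<noteq> {}} = Tol C"
      using sum_block_meets_iff tol_carrier by blast
    then show ?thesis using tolerance by simp
  qed
  show "sum_block C x \<inter> sum_block C y \<noteq> {}" if "covers (Skel C) x y" for x y
    using that MC8_1[OF that] sum_block_meets_iff by (simp add: covers_def)
  show "\<not> sum_block C x \<subseteq> sum_block C y \<and> \<not> sum_block C y \<subseteq> sum_block C x"
    if cov: "covers (Skel C) x y" for x y
  proof -
    have c: "x \<in> carrier (Skel C)" "y \<in> carrier (Skel C)" "x \<le>\<^sub>S y"
      using cov by (simp_all add: covers_def lless_def)
    have xy: "tol_le C x y" using c(3) MC8_1[OF cov] by (rule tol_leI)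
    have "\<exists>a \<in> carrier (Blk C x). a \<notin> Fil C x y" "\<exists>b \<in> carrier (Blk C y). b \<notin> Idl C x y"
      using MC8_2[OF cov] Fil_subset[OF xy] Idl_subset[OF xy] by blast+
    then show ?thesis
      using sum_proj_mem_upper[OF c] sum_proj_mem_lower[OF c] unfolding sum_block_def by blast
  qed
qed ((fact sum_block_join sum_block_meet sum_block_between)+,
    (blast intro: sum_le_at_up sum_le_at_down)+)

interpretation G: gluing "Skel C" block_order
  rewrites "carrier (block_order x) = sum_block C x" and "le (block_order x) = sum_le_at C x"
  by (rule gluing) simp_all

section \<open>Chains defining the order of the sum\<close>

definition index_chain :: "nat \<Rightarrow> (nat \<Rightarrow> 's) \<Rightarrow> (nat \<Rightarrow> ('s \<times> 'a) set) \<Rightarrow> bool" where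
  "index_chain n x c \<longleftrightarrow>
     (\<forall>i \<in> {1..n}. x i \<in> carrier (Skel C) \<and> sum_le_at C (x i) (c (i - 1)) (c i))
     \<and> (\<forall>i \<in> {1..<n}. x i \<le>\<^sub>S x (i + 1))"

lemma sum_le_iff_index_chain:
  "sum_le C \<alpha> \<beta> \<longleftrightarrow> \<alpha> \<in> sum_points C // sum_rel C \<and> \<beta> \<in> sum_points C // sum_rel C
    \<and> (\<exists>n x c. c 0 = \<alpha> \<and> c n = \<beta> \<and> index_chain n x c)"
  unfolding sum_le_def index_chain_def by (rule refl)

text \<open>A \<open>reach\<close> may raise its index after the last move, so the last recorded
  index is only bounded by \<open>v\<close>; this bound keeps the indices monotone when a step is
  added. The guard \<open>0 < n\<close> is there because the empty chain records no index.\<close>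

lemma reach_imp_chain:
  assumes "G.reach u \<alpha> v \<beta>"
  shows "\<exists>n x c. index_chain n x c \<and> c 0 = \<alpha> \<and> c n = \<beta> \<and> (0 < n \<longrightarrow> x n \<le>\<^sub>S v)"
  using assms
proof (induction)
  case (reach_refl x a)
  show ?case
    by (intro exI[of _ 0] exI[of _ "\<lambda>_. x"] exI[of _ "\<lambda>_. a"]) (simp add: index_chain_def)
next
  case (reach_step u a y b d z)
  from reach_step.IH obtain n x c where
    chain: "index_chain n x c" and IH: "c 0 = a" "c n = b" "0 < n \<longrightarrow> x n \<le>\<^sub>S y" by blast
  have y: "y \<in> carrier (Skel C)" by (rule G.reach_mem(2)[OF reach_step.hyps(1)])
  \<comment> \<open>The recorded index is \<open>y\<close>, in whose block the move takes place;
    \<open>z\<close> enters only through the invariant.\<close>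
  let ?x = "x(Suc n := y)" and ?c = "c(Suc n := d)"
  have "index_chain (Suc n) ?x ?c"
    unfolding index_chain_def
  proof (intro conjI)
    show "\<forall>i \<in> {1..Suc n}. ?x i \<in> carrier (Skel C) \<and> sum_le_at C (?x i) (?c (i - 1)) (?c i)"
    proof
      have step: "sum_le_at C y b d" by (rule reach_step.hyps(3))
      fix i assume "i \<in> {1..Suc n}"
      then consider "i \<in> {1..n}" | "i = Suc n" by fastforce
      then show "?x i \<in> carrier (Skel C) \<and> sum_le_at C (?x i) (?c (i - 1)) (?c i)"
      proof cases
        case 1
        moreover from this have "i \<noteq> Suc n" "i - 1 \<noteq> Suc n" by auto
        ultimately show ?thesis using chain unfolding index_chain_def by simp
      next
        case 2
        then show ?thesis using IH(2) y step by simp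
      qed
    qed
    show "\<forall>i \<in> {1..<Suc n}. ?x i \<le>\<^sub>S ?x (i + 1)"
    proof
      fix i assume "i \<in> {1..<Suc n}"
      then consider "i \<in> {1..<n}" | "i = n" "0 < n" by fastforce
      then show "?x i \<le>\<^sub>S ?x (i + 1)"
        using chain IH(3) unfolding index_chain_def by cases simp_all
    qed
  qed
  moreover have "?c 0 = a" "?c (Suc n) = d" "?x (Suc n) \<le>\<^sub>S z"
    using IH(1) reach_step.hyps(5) by simp_all
  ultimately show ?case by blast
qed

lemma chain_imp_reach:
  assumes "c 0 \<in> sum_points C // sum_rel C" and "index_chain n x c"
  shows "\<exists>u v. G.reach u (c 0) v (c n) \<and> (0 < n \<longrightarrow> v = x n)"
  using assms(2)
proof (induction n)
  case 0
  then show ?case using assms(1) G.reach_refl unfolding sum_quotient by blast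
next
  case (Suc n)
  have y: "x (Suc n) \<in> carrier (Skel C)" "sum_le_at C (x (Suc n)) (c n) (c (Suc n))"
    using Suc.prems unfolding index_chain_def by (auto dest: bspec[of _ _ "Suc n"])
  then have m: "c n \<in> sum_block C (x (Suc n))" "c (Suc n) \<in> sum_block C (x (Suc n))"
    by (simp_all add: sum_le_at_def)
  have r: "G.reach (x (Suc n)) (c n) (x (Suc n)) (c (Suc n))" using G.reach_block y m by blast
  show ?case
  proof (cases "n = 0")
    case True
    then show ?thesis using r by auto
  next
    case False
    have "\<exists>u v. G.reach u (c 0) v (c n) \<and> (0 < n \<longrightarrow> v = x n)"
      using Suc.prems unfolding index_chain_def by (intro Suc.IH[unfolded index_chain_def]) simp_all
    then obtain u where u: "G.reach u (c 0) (x n) (c n)" using False by auto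
    have "x n \<le>\<^sub>S x (Suc n)" using Suc.prems False unfolding index_chain_def by simp
    \<comment> \<open>The element \<open>c n\<close> ends the step at \<open>x n\<close> and begins
      the next one, so it lies in both blocks and the index may change at it.\<close>
    then have "G.reach (x n) (c n) (x (Suc n)) (c n)"
      using G.reach_index G.reach_mem[OF u] y m by blast
    then have "G.reach u (c 0) (x (Suc n)) (c (Suc n))"
      using G.reach_trans r u by blast
    then show ?thesis by blast
  qed
qed

text \<open>The two records are equal, not merely isomorphic, so results on the glued order apply to
  the sum by rewriting.\<close>

lemma mc_sum_eq_glued: "mc_sum C = G.glued"
proof -
  have "sum_le C \<alpha> \<beta> \<longleftrightarrow> G.glued_le \<alpha> \<beta>" for \<alpha> \<beta>
  proof
    assume "sum_le C \<alpha> \<beta>"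
    then obtain n x c where chain: "index_chain n x c" and c: "c 0 = \<alpha>" "c n = \<beta>"
      and \<alpha>: "\<alpha> \<in> sum_points C // sum_rel C" unfolding sum_le_iff_index_chain by blast
    show "G.glued_le \<alpha> \<beta>"
      using chain_imp_reach[OF _ chain] \<alpha> unfolding c G.glued_le_def by blast
  next
    assume "G.glued_le \<alpha> \<beta>"
    then obtain u v where r: "G.reach u \<alpha> v \<beta>" unfolding G.glued_le_def by blast
    note m = G.reach_mem[OF r]
    show "sum_le C \<alpha> \<beta>"
      unfolding sum_le_iff_index_chain sum_quotient using reach_imp_chain[OF r] m by blast
  qed
  then have "sum_le C = G.glued_le" by (simp add: fun_eq_iff)
  then show ?thesis unfolding mc_sum_def G.glued_def sum_quotient by simp
qed

section \<open>The isomorphism between the dissection and the system\<close>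

lemma restricted_block_iso:
  assumes x: "x \<in> carrier (Skel C)"
  shows "order_isomorphism (Blk C x) ((mc_sum C)\<lparr>carrier := sum_block C x\<rparr>) (sum_proj C x)"
proof -
  interpret I: order_isomorphism "Blk C x" "block_order x" "sum_proj C x"
    by (rule block_order_iso[OF x])
  have m: "sum_proj C x a \<in> sum_block C x" if "a \<in> carrier (Blk C x)" for a
    using that by (simp add: sum_block_def)
  show ?thesis
  proof
    show "bij_betw (sum_proj C x) (carrier (Blk C x)) (carrier ((mc_sum C)\<lparr>carrier := sum_block C x\<rparr>))"
      using I.bij by simp
    show "eq ((mc_sum C)\<lparr>carrier := sum_block C x\<rparr>) = (=)" by (simp add: mc_sum_def)
    show "sum_proj C x a \<sqsubseteq>\<^bsub>(mc_sum C)\<lparr>carrier := sum_block C x\<rparr>\<^esub> sum_proj C x b \<longleftrightarrow> a \<sqsubseteq>\<^bsub>Blk C x\<^esub> b"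
      if "a \<in> carrier (Blk C x)" "b \<in> carrier (Blk C x)" for a b
      using G.glued_le_iff[OF x m m] sum_le_at_proj[OF x] that unfolding mc_sum_eq_glued by simp
  qed
qed

text \<open>The natural maps, from an index to its block and from \<open>Blk C x\<close> into the
  sum, run from the system to the dissection. The isomorphism required here runs the other way and
  consists of their inverses, evaluated by writing each block as
  \<open>sum_block C x\<close>.\<close>

lemma dissection_mc_sum_isomorphism:
  defines "\<chi>S \<equiv> the_inv_into (carrier (Skel C)) (sum_block C)"
  shows "mc_isomorphism (dissection (mc_sum C)) C \<chi>S
    (\<lambda>X. the_inv_into (carrier (Blk C (\<chi>S X))) (sum_proj C (\<chi>S X)))"
proof -
  let ?D = "dissection (mc_sum C)"
  let ?\<chi> = "\<lambda>X. the_inv_into (carrier (Blk C (\<chi>S X))) (sum_proj C (\<chi>S X))"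
  interpret K: order_isomorphism "Skel C" "block_skeleton (mc_sum C)" "sum_block C"
    unfolding mc_sum_eq_glued by (rule G.skeleton_iso)
  interpret K': order_isomorphism "block_skeleton (mc_sum C)" "Skel C" \<chi>S
    unfolding \<chi>S_def by (rule K.inverse)
  have \<chi>S: "\<chi>S (sum_block C x) = x" if "x \<in> carrier (Skel C)" for x
    using K.bij that by (simp add: \<chi>S_def bij_betw_def the_inv_into_f_f)
  have \<chi>: "?\<chi> (sum_block C x) (sum_proj C x a) = a"
    if "x \<in> carrier (Skel C)" "a \<in> carrier (Blk C x)" for x a
    using the_inv_into_f_f[OF sum_proj_inj] that \<chi>S by simp
  have blocks: "\<exists>x \<in> carrier (Skel C). X = sum_block C x" if "X \<in> carrier (block_skeleton (mc_sum C))" for X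
    using that unfolding K.image_carrier[symmetric] by blast
  have is_block: "is_block (mc_sum C) (sum_block C x)" if "x \<in> carrier (Skel C)" for x
    using that G.is_block_glued_iff unfolding mc_sum_eq_glued by blast
  show ?thesis
    unfolding mc_isomorphism_def dissection_simps
  proof (intro conjI ballI allI impI)
    show "mc_system ?D" unfolding mc_sum_eq_glued by (rule G.dissection_mc_system)
    show "mc_system C" by (rule mc_system_axioms)
    show "lattice_iso (block_skeleton (mc_sum C)) (Skel C) \<chi>S"
      using K'.lattice_iso K.lattice_target skeleton_lattice by blast
  next
    fix X assume "X \<in> carrier (block_skeleton (mc_sum C))"
    then obtain x where x: "x \<in> carrier (Skel C)" "X = sum_block C x" using blocks by blast
    interpret I: order_isomorphism "Blk C x" "(mc_sum C)\<lparr>carrier := sum_block C x\<rparr>" "sum_proj C x"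
      by (rule restricted_block_iso[OF x(1)])
    have "lattice (Blk C x)" using MC2[OF x(1)] by (simp add: modular_lattice_def)
    then have "lattice_iso ((mc_sum C)\<lparr>carrier := sum_block C x\<rparr>) (Blk C x)
      (the_inv_into (carrier (Blk C x)) (sum_proj C x))"
      using order_isomorphism.lattice_iso[OF I.inverse] I.lattice_target by blast
    then show "lattice_iso ((mc_sum C)\<lparr>carrier := X\<rparr>) (Blk C (\<chi>S X)) (?\<chi> X)"
      unfolding x(2) \<chi>S[OF x(1)] .
  next
    fix X Y assume "X \<in> carrier (block_skeleton (mc_sum C))" "Y \<in> carrier (block_skeleton (mc_sum C))"
    then obtain x y where xy: "x \<in> carrier (Skel C)" "y \<in> carrier (Skel C)"
      and eq: "X = sum_block C x" "Y = sum_block C y" using blocks by meson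
    show "(X, Y) \<in> {(B, B'). is_block (mc_sum C) B \<and> is_block (mc_sum C) B' \<and> B \<inter> B' \<noteq> {}}
      \<longleftrightarrow> (\<chi>S X, \<chi>S Y) \<in> Tol C"
      unfolding eq using sum_block_meets_iff[OF xy] is_block xy \<chi>S by simp
  next
    fix X Y assume XY: "tol_le ?D X Y"
    then have "X \<in> carrier (block_skeleton (mc_sum C))" "Y \<in> carrier (block_skeleton (mc_sum C))"
      by (simp_all add: tol_le_def block_skeleton_def)
    then obtain x y where xy: "x \<in> carrier (Skel C)" "y \<in> carrier (Skel C)"
      and eq: "X = sum_block C x" "Y = sum_block C y" using blocks by meson
    have "x \<le>\<^sub>S y" "(x, y) \<in> Tol C"
      using XY K.le_iff[OF xy] sum_block_meets_iff[OF xy] by (simp_all add: tol_le_def eq)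
    then have t: "tol_le C x y" by (rule tol_leI)
    \<comment> \<open>The overlap has two descriptions, as an image of the filter in
      \<open>Blk C x\<close> and of the ideal in \<open>Blk C y\<close>; they settle the conditions
      on filters and on ideals respectively.\<close>
    note inter = sum_block_inter[OF t]
    have fil: "?\<chi> X (sum_proj C x a) = a" if "a \<in> Fil C x y" for a
      using \<chi>[OF xy(1)] Fil_subset[OF t] that unfolding eq by blast
    have idl: "?\<chi> Y (sum_proj C y b) = b" if "b \<in> Idl C x y" for b
      using \<chi>[OF xy(2)] Idl_subset[OF t] that unfolding eq by blast
    have "?\<chi> X ` sum_proj C x ` Fil C x y = Fil C x y"
      unfolding image_image using fil by (simp cong: image_cong_simp)
    then show "Fil C (\<chi>S X) (\<chi>S Y) = ?\<chi> X ` (X \<inter> Y)"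
      unfolding eq \<chi>S[OF xy(1)] \<chi>S[OF xy(2)] inter(1) by simp
    have "?\<chi> Y ` sum_proj C y ` Idl C x y = Idl C x y"
      unfolding image_image using idl by (simp cong: image_cong_simp)
    then show "Idl C (\<chi>S X) (\<chi>S Y) = ?\<chi> Y ` (X \<inter> Y)"
      unfolding eq \<chi>S[OF xy(1)] \<chi>S[OF xy(2)] inter(2) by simp
    fix \<alpha> assume "\<alpha> \<in> X \<inter> Y"
    then obtain a where a: "a \<in> Fil C x y" "\<alpha> = sum_proj C x a" unfolding eq inter(1) by blast
    \<comment> \<open>A point of the overlap has the representatives \<open>a\<close> at
      \<open>x\<close> and \<open>Phi C x y a\<close> at \<open>y\<close>. Hence the identity of the
      dissection corresponds to \<open>Phi C x y\<close>.\<close>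
    then have "\<alpha> = sum_proj C y (Phi C x y a)" using sum_proj_Phi[OF t] by simp
    then have "?\<chi> Y \<alpha> = Phi C x y a" using idl Phi_Idl[OF a(1)] by simp
    then show "?\<chi> Y \<alpha> = Phi C (\<chi>S X) (\<chi>S Y) (?\<chi> X \<alpha>)"
      using fil[OF a(1)] a(2) \<chi>S[OF xy(1)] \<chi>S[OF xy(2)] unfolding eq by simp
  qed
qed

end

theorem theorem6p7:
  fixes C :: "('s, 'a) mc_data"
  assumes "mc_system C"
  shows "mc_isomorphic (dissection (mc_sum C)) C"
  unfolding mc_isomorphic_def
  using mc_system.dissection_mc_sum_isomorphism[OF assms] by blast

end
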